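(* Let $m\ge1$ be an integer and let $q_0,q_1,\dots,q_m$ and $c_1,\dots,c_{m-1},c_{\overline1},\dots,c_{\overline m}$ be commuting indeterminates. Then \begin{align*} \sum_{\lambda\in \overline{\mathcal{P}}_m} \left(\prod_{j=1}^{m-1} c_j^{\rho_j(\lambda)}c_{\overline{j}}^{\rho_{\overline{j}}(\lambda)} \right)c_{\overline{m}}^{\rho_{\overline{m}}(\lambda)}q_0^{|\lambda|}\prod_{i=1}^m q_i^{\sum_{j\geq 0}\lambda_{i+jm}} &= (-c_{\overline{m}}q_0^m q_1\cdots q_m;q_0^m q_1\cdots q_m)_\infty\\ &\qquad\times\prod_{i=1}^{m-1}\frac{(-c_{\overline{i}}q_0^i q_1\cdots q_i;q_0^m q_1\cdots q_m)_\infty}{(c_{i}q_0^i q_1\cdots q_i;q_0^m q_1\cdots q_m)_\infty},\\ \sum_{\lambda\in \mathcal{P}_m} \left(\prod_{j=1}^{m-1} c_j^{\rho_j(\lambda)}\right) q_0^{|\lambda|}\prod_{i=1}^m q_i^{\sum_{j\geq 0}\lambda_{i+jm}} &= \prod_{i=1}^{m-1}\frac{1}{(c_{i}q_0^i q_1\cdots q_i;q_0^m q_1\cdots q_m)_\infty},\\ \sum_{\lambda\in \overline{\mathcal{F}}_m} \left(\prod_{j=1}^m c_{\overline{j}}^{\rho_{\overline{j}}(\lambda)} \right)q_0^{|\lambda|}\prod_{i=1}^m q_i^{\sum_{j\geq 0}\lambda_{i+jm}} &= \prod_{i=1}^m(-c_{\overline{i}}q_0^i q_1\cdots q_i;q_0^m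 q_1\cdots q_m)_\infty. \end{align*}
   Context: Over-lined integers: $\overline{\mathbb{Z}_{\geq 1}}=\{\overline1,\overline2,\ldots\}$ is a disjoint copy of $\mathbb{Z}_{\ge 1}$; both $i$ and $\overline i$ have size $i$; sums and differences use sizes. Order: $0<\overline1<1<\overline2<2<\cdots$. An over-partition is an infinite non-increasing sequence $\lambda=(\lambda_i)_{i\ge1}$ of elements of $\mathbb{Z}_{\geq 0}\sqcup\overline{\mathbb{Z}_{\geq 1}}$ with finitely many nonzero terms, in which each over-lined integer occurs at most once. $|\lambda|=\sum_i\lambda_i$ is the sum of sizes. Write $\chi(A)=1$ if $A$ is true and $0$ otherwise. $\overline{\mathcal P}_m$: over-partitions in which every positive integer has fewer than $m$ non-over-lined occurrences. $\mathcal P_m$: elements of $\overline{\mathcal P}_m$ without over-lined parts. $\overline{\mathcal F}_m$: elements $\lambda$ of $\overline{\mathcal P}_m$ such that $\lambda_i-\lambda_{i+1}=\chi(\lambda_i\text{ is over-lined})$ for all $i\ge1$ not divisible by $m$. For $1\le j\le m$, $$\rho_j(\lambda)=\sum_{i\ge0}\bigl(\lambda_{j+im}-\lambda_{j+1+im}-\chi(\lambda_{j+im}\text{ is over-lined})\bigr),\qquad \rho_{\overline j}(\lambda)=\#\{i\ge0:\lambda_{j+im}\text{ is over-lined}\}.$$ $(a;x)_\infty=\prod_{k\ge0}(1-ax^k)$. Identities are between formal power series in the indeterminates. *)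

theory Defs
  imports "HOL-Analysis.Analysis" "HOL-Library.Poly_Mapping"
begin

section \<open>Formal power series in an arbitrary set of indeterminates\<close>

text \<open>
  A monomial in indeterminates from \<open>'v\<close> is a finitely supported exponent function
  \<open>'v \<Rightarrow>\<^sub>0 nat\<close>; a formal power series is an arbitrary family of coefficients
  indexed by monomials.
\<close>

typedef (overloaded) ('v, 'a) mfps = "UNIV :: (('v \<Rightarrow>\<^sub>0 nat) \<Rightarrow> 'a) set"
  morphisms mcoeff Abs_mfps ..

lemma mcoeff_Abs [simp]: "mcoeff (Abs_mfps f) = f"
  by (simp add: Abs_mfps_inverse)

lemma mfps_eqI: "(\<And>\<mu>. mcoeff f \<mu> = mcoeff g \<mu>) \<Longrightarrow> f = g"
  by (metis ext mcoeff_inject)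

definition msplits :: "('v \<Rightarrow>\<^sub>0 nat) \<Rightarrow> (('v \<Rightarrow>\<^sub>0 nat) \<times> ('v \<Rightarrow>\<^sub>0 nat)) set" where
  "msplits \<mu> = {(\<alpha>, \<beta>). \<alpha> + \<beta> = \<mu>}"

lemma in_msplits [simp]: "(\<alpha>, \<beta>) \<in> msplits \<mu> \<longleftrightarrow> \<alpha> + \<beta> = \<mu>"
  by (simp add: msplits_def)

lemma finite_msplits [simp]: "finite (msplits \<mu>)"
proof -
  let ?K = "Poly_Mapping.keys \<mu>"
  let ?B = "{..Max (insert 0 (Poly_Mapping.lookup \<mu> ` ?K))}"
  let ?F = "{f. \<forall>x. (x \<in> ?K \<longrightarrow> f x \<in> ?B) \<and> (x \<notin> ?K \<longrightarrow> f x = (0::nat))}"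
  let ?A = "{\<alpha>. \<exists>\<beta>. \<alpha> + \<beta> = \<mu>}"
  have fF: "finite ?F"
    by (rule finite_set_of_finite_funs) auto
  have "Poly_Mapping.lookup ` ?A \<subseteq> ?F"
  proof
    fix f assume "f \<in> Poly_Mapping.lookup ` ?A"
    then obtain \<alpha> \<beta> where f: "f = Poly_Mapping.lookup \<alpha>" and \<mu>: "\<mu> = \<alpha> + \<beta>"
      by blast
    have le: "f x \<le> Poly_Mapping.lookup \<mu> x" for x
      by (simp add: f \<mu> lookup_add)
    have "f x \<in> ?B" if "x \<in> ?K" for x
    proof -
      have "Poly_Mapping.lookup \<mu> x \<le> Max (insert 0 (Poly_Mapping.lookup \<mu> ` ?K))"
        using that by (intro Max_ge) auto
      with le[of x] show ?thesis by simp
    qed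
    moreover have "f x = 0" if "x \<notin> ?K" for x
      using le[of x] that by (simp add: not_in_keys_iff_lookup_eq_zero)
    ultimately show "f \<in> ?F" by blast
  qed
  then have "finite (Poly_Mapping.lookup ` ?A)"
    using fF finite_subset by blast
  then have fA: "finite ?A"
    by (rule finite_imageD) (rule inj_onI, simp add: lookup_inject)
  have "msplits \<mu> \<subseteq> ?A \<times> ?A"
  proof
    fix p assume "p \<in> msplits \<mu>"
    then have "fst p + snd p = \<mu>" "snd p + fst p = \<mu>"
      by (auto simp: msplits_def add.commute)
    then show "p \<in> ?A \<times> ?A"
      by (cases p) auto
  qed
  then show ?thesis
    using fA finite_subset by blast
qed

instantiation mfps :: (type, comm_ring_1) comm_ring_1
begin

definition zero_mfps :: "('a, 'b) mfps" where
  "0 = Abs_mfps (\<lambda>_. 0)"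

definition one_mfps :: "('a, 'b) mfps" where
  "1 = Abs_mfps (\<lambda>\<mu>. if \<mu> = 0 then 1 else 0)"

definition plus_mfps :: "('a, 'b) mfps \<Rightarrow> ('a, 'b) mfps \<Rightarrow> ('a, 'b) mfps" where
  "f + g = Abs_mfps (\<lambda>\<mu>. mcoeff f \<mu> + mcoeff g \<mu>)"

definition minus_mfps :: "('a, 'b) mfps \<Rightarrow> ('a, 'b) mfps \<Rightarrow> ('a, 'b) mfps" where
  "f - g = Abs_mfps (\<lambda>\<mu>. mcoeff f \<mu> - mcoeff g \<mu>)"

definition uminus_mfps :: "('a, 'b) mfps \<Rightarrow> ('a, 'b) mfps" where
  "- f = Abs_mfps (\<lambda>\<mu>. - mcoeff f \<mu>)"

definition times_mfps :: "('a, 'b) mfps \<Rightarrow> ('a, 'b) mfps \<Rightarrow> ('a, 'b) mfps" where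
  "f * g = Abs_mfps (\<lambda>\<mu>. \<Sum>(\<alpha>, \<beta>)\<in>msplits \<mu>. mcoeff f \<alpha> * mcoeff g \<beta>)"

lemma mcoeff_simps [simp]:
  "mcoeff (0 :: ('a, 'b) mfps) \<mu> = 0"
  "mcoeff (1 :: ('a, 'b) mfps) \<mu> = (if \<mu> = 0 then 1 else 0)"
  "mcoeff (f + g :: ('a, 'b) mfps) \<mu> = mcoeff f \<mu> + mcoeff g \<mu>"
  "mcoeff (f - g :: ('a, 'b) mfps) \<mu> = mcoeff f \<mu> - mcoeff g \<mu>"
  "mcoeff (- f :: ('a, 'b) mfps) \<mu> = - mcoeff f \<mu>"
  by (simp_all add: zero_mfps_def one_mfps_def plus_mfps_def minus_mfps_def uminus_mfps_def)

lemma mcoeff_mult: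
  "mcoeff (f * g :: ('a, 'b) mfps) \<mu> = (\<Sum>(\<alpha>, \<beta>)\<in>msplits \<mu>. mcoeff f \<alpha> * mcoeff g \<beta>)"
  by (simp add: times_mfps_def)

instance
proof
  fix f g h :: "('a, 'b) mfps"
  show "f * g * h = f * (g * h)"
  proof (rule mfps_eqI)
    fix \<mu> :: "'a \<Rightarrow>\<^sub>0 nat"
    have "mcoeff (f * g * h) \<mu> =
        (\<Sum>(p, q)\<in>Sigma (msplits \<mu>) (\<lambda>p. msplits (fst p)).
           mcoeff f (fst q) * mcoeff g (snd q) * mcoeff h (snd p))"
      by (simp add: mcoeff_mult case_prod_unfold sum_distrib_right sum.Sigma)
    also have "\<dots> = (\<Sum>(p, q)\<in>Sigma (msplits \<mu>) (\<lambda>p. msplits (snd p)).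
           mcoeff f (fst p) * (mcoeff g (fst q) * mcoeff h (snd q)))"
      by (rule sum.reindex_bij_witness[where
            i = "\<lambda>(p, q). ((fst p + fst q, snd q), (fst p, fst q))" and
            j = "\<lambda>(p, q). ((fst q, snd q + snd p), (snd q, snd p))"])
         (auto simp: algebra_simps)
    also have "\<dots> = mcoeff (f * (g * h)) \<mu>"
      by (simp add: mcoeff_mult case_prod_unfold sum_distrib_left sum.Sigma)
    finally show "mcoeff (f * g * h) \<mu> = mcoeff (f * (g * h)) \<mu>" .
  qed
  show "f * g = g * f"
  proof (rule mfps_eqI)
    fix \<mu> :: "'a \<Rightarrow>\<^sub>0 nat"
    show "mcoeff (f * g) \<mu> = mcoeff (g * f) \<mu>"
      unfolding mcoeff_mult
      by (rule sum.reindex_bij_witness[where i = prod.swap and j = prod.swap])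
         (auto simp: algebra_simps)
  qed
  show "1 * f = f"
  proof (rule mfps_eqI)
    fix \<mu> :: "'a \<Rightarrow>\<^sub>0 nat"
    have "mcoeff (1 * f) \<mu> = (\<Sum>p\<in>msplits \<mu>. if p = (0, \<mu>) then mcoeff f \<mu> else 0)"
      unfolding mcoeff_mult by (rule sum.cong) (auto split: if_splits)
    then show "mcoeff (1 * f) \<mu> = mcoeff f \<mu>"
      by (simp add: sum.delta)
  qed
  show "(f + g) * h = f * h + g * h"
    by (rule mfps_eqI) (simp add: mcoeff_mult case_prod_unfold algebra_simps sum.distrib)
  have "mcoeff (0 :: ('a, 'b) mfps) 0 \<noteq> mcoeff 1 0"
    by simp
  then show "(0 :: ('a, 'b) mfps) \<noteq> 1"
    by metis
qed (rule mfps_eqI, simp add: algebra_simps)+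

end

text \<open>
  The topology is that of coefficientwise convergence: the product over all monomials of the
  discrete topology on the coefficients.
\<close>

instantiation mfps :: (type, comm_ring_1) t2_space
begin

definition open_mfps :: "('a, 'b) mfps set \<Rightarrow> bool" where
  "open S \<longleftrightarrow> (\<forall>f\<in>S. \<exists>M. finite M \<and>
     (\<forall>g. (\<forall>\<mu>\<in>M. mcoeff g \<mu> = mcoeff f \<mu>) \<longrightarrow> g \<in> S))"

instance
proof
  show "open (UNIV :: ('a, 'b) mfps set)"
    by (auto simp: open_mfps_def)
next
  fix S T :: "('a, 'b) mfps set"
  assume S: "open S" and T: "open T"
  show "open (S \<inter> T)"
    unfolding open_mfps_def
  proof
    fix f assume f: "f \<in> S \<inter> T"
    obtain M where M: "finite M" "\<forall>g. (\<forall>\<mu>\<in>M. mcoeff g \<mu> = mcoeff f \<mu>) \<longrightarrow> g \<in> S"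
      using S f unfolding open_mfps_def by blast
    obtain N where N: "finite N" "\<forall>g. (\<forall>\<mu>\<in>N. mcoeff g \<mu> = mcoeff f \<mu>) \<longrightarrow> g \<in> T"
      using T f unfolding open_mfps_def by blast
    show "\<exists>M. finite M \<and> (\<forall>g. (\<forall>\<mu>\<in>M. mcoeff g \<mu> = mcoeff f \<mu>) \<longrightarrow> g \<in> S \<inter> T)"
      by (rule exI[of _ "M \<union> N"]) (use M N in auto)
  qed
next
  fix K :: "('a, 'b) mfps set set"
  assume K: "\<forall>S\<in>K. open S"
  show "open (\<Union>K)"
    unfolding open_mfps_def
  proof
    fix f assume "f \<in> \<Union>K"
    then obtain S where S: "S \<in> K" "f \<in> S" by blast
    then obtain M where "finite M" "\<forall>g. (\<forall>\<mu>\<in>M. mcoeff g \<mu> = mcoeff f \<mu>) \<longrightarrow> g \<in> S"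
      using K unfolding open_mfps_def by blast
    then show "\<exists>M. finite M \<and> (\<forall>g. (\<forall>\<mu>\<in>M. mcoeff g \<mu> = mcoeff f \<mu>) \<longrightarrow> g \<in> \<Union>K)"
      using S by blast
  qed
next
  fix f g :: "('a, 'b) mfps"
  assume "f \<noteq> g"
  then obtain \<mu> where \<mu>: "mcoeff f \<mu> \<noteq> mcoeff g \<mu>"
    using mfps_eqI by blast
  have op: "open {h :: ('a, 'b) mfps. mcoeff h \<mu> = c}" for c
    unfolding open_mfps_def by (auto intro!: exI[of _ "{\<mu>}"])
  show "\<exists>U V. open U \<and> open V \<and> f \<in> U \<and> g \<in> V \<and> U \<inter> V = {}"
    by (rule exI[of _ "{h. mcoeff h \<mu> = mcoeff f \<mu>}"],
        rule exI[of _ "{h. mcoeff h \<mu> = mcoeff g \<mu>}"]) (use \<mu> op in auto)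
qed

end

lemma tendsto_mfps_iff:
  fixes L :: "('v, 'a::comm_ring_1) mfps"
  shows "(f \<longlongrightarrow> L) F \<longleftrightarrow> (\<forall>\<mu>. eventually (\<lambda>x. mcoeff (f x) \<mu> = mcoeff L \<mu>) F)"
proof
  assume lim: "(f \<longlongrightarrow> L) F"
  show "\<forall>\<mu>. eventually (\<lambda>x. mcoeff (f x) \<mu> = mcoeff L \<mu>) F"
  proof
    fix \<mu>
    have "open {h :: ('v, 'a) mfps. mcoeff h \<mu> = mcoeff L \<mu>}"
      unfolding open_mfps_def by (auto intro!: exI[of _ "{\<mu>}"])
    from topological_tendstoD[OF lim this]
    show "eventually (\<lambda>x. mcoeff (f x) \<mu> = mcoeff L \<mu>) F"
      by simp
  qed
next
  assume ev: "\<forall>\<mu>. eventually (\<lambda>x. mcoeff (f x) \<mu> = mcoeff L \<mu>) F"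
  show "(f \<longlongrightarrow> L) F"
  proof (rule topological_tendstoI)
    fix S assume "open S" "L \<in> S"
    then obtain M where M: "finite M" "\<forall>g. (\<forall>\<mu>\<in>M. mcoeff g \<mu> = mcoeff L \<mu>) \<longrightarrow> g \<in> S"
      unfolding open_mfps_def by blast
    have "eventually (\<lambda>x. \<forall>\<mu>\<in>M. mcoeff (f x) \<mu> = mcoeff L \<mu>) F"
      using M(1) ev by (simp add: eventually_ball_finite)
    then show "eventually (\<lambda>x. f x \<in> S) F"
      by eventually_elim (use M(2) in blast)
  qed
qed

text \<open>
  The inverse is the unique multiplicative inverse, where one exists; it exists for every series
  with constant coefficient 1 (lemma \<open>mfps_right_inverse\<close>).
\<close>

definition mfps_inv :: "('v, 'a::comm_ring_1) mfps \<Rightarrow> ('v, 'a) mfps" where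
  "mfps_inv f = (if \<exists>g. f * g = 1 then THE g. f * g = 1 else 0)"

instantiation mfps :: (type, comm_ring_1) inverse
begin

definition inverse_mfps :: "('a, 'b) mfps \<Rightarrow> ('a, 'b) mfps" where
  "inverse_mfps = mfps_inv"

definition divide_mfps :: "('a, 'b) mfps \<Rightarrow> ('a, 'b) mfps \<Rightarrow> ('a, 'b) mfps" where
  "divide_mfps f g = f * mfps_inv g"

instance ..

end

lemma mfps_inverse_unique:
  fixes f g :: "('v, 'a::comm_ring_1) mfps"
  assumes "f * g = 1"
  shows "inverse f = g"
proof -
  have "h = g" if "f * h = 1" for h
  proof -
    have "h = (f * g) * h" using assms by simp
    also have "\<dots> = (f * h) * g" by (simp only: mult_ac)
    finally show ?thesis using that by simp
  qed
  then have "(THE h. f * h = 1) = g"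
    using assms by (rule the_equality[rotated])
  moreover have "\<exists>h. f * h = 1"
    using assms by blast
  ultimately show ?thesis
    by (simp add: inverse_mfps_def mfps_inv_def)
qed

definition mdegree :: "('v \<Rightarrow>\<^sub>0 nat) \<Rightarrow> nat" where
  "mdegree \<mu> = (\<Sum>v\<in>Poly_Mapping.keys \<mu>. Poly_Mapping.lookup \<mu> v)"

lemma mdegree_add: "mdegree (\<alpha> + \<beta>) = mdegree \<alpha> + mdegree \<beta>"
proof -
  let ?K = "Poly_Mapping.keys \<alpha> \<union> Poly_Mapping.keys \<beta>"
  have *: "mdegree \<gamma> = (\<Sum>v\<in>?K. Poly_Mapping.lookup \<gamma> v)"
    if "Poly_Mapping.keys \<gamma> \<subseteq> ?K" for \<gamma>
    unfolding mdegree_def using that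
    by (intro sum.mono_neutral_left) (auto simp: not_in_keys_iff_lookup_eq_zero)
  show ?thesis
    using *[of \<alpha>] *[of \<beta>] *[of "\<alpha> + \<beta>"] keys_add[of \<alpha> \<beta>]
    by (simp add: lookup_add sum.distrib)
qed

lemma mdegree_eq_0_iff: "mdegree \<mu> = 0 \<longleftrightarrow> \<mu> = 0"
  by (auto simp: mdegree_def not_in_keys_iff_lookup_eq_zero intro!: poly_mapping_eqI)

lemma mcoeff_power_eq_0:
  fixes h :: "('v, 'a::comm_ring_1) mfps"
  assumes "mcoeff h 0 = 0" "mdegree \<mu> < k"
  shows "mcoeff (h ^ k) \<mu> = 0"
  using assms(2)
proof (induction k arbitrary: \<mu>)
  case 0
  then show ?case by simp
next
  case (Suc k)
  have "mcoeff h \<alpha> * mcoeff (h ^ k) \<beta> = 0" if "\<alpha> + \<beta> = \<mu>" for \<alpha> \<beta>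
  proof (cases "\<alpha> = 0")
    case True
    then show ?thesis using assms(1) by simp
  next
    case False
    then have "mdegree \<alpha> > 0" by (metis mdegree_eq_0_iff neq0_conv)
    then have "mdegree \<beta> < k" using Suc.prems that mdegree_add[of \<alpha> \<beta>] by simp
    then show ?thesis using Suc.IH by simp
  qed
  then show ?case
    by (auto simp: mcoeff_mult intro!: sum.neutral)
qed

lemma mfps_right_inverse:
  fixes f :: "('v, 'a::comm_ring_1) mfps"
  assumes "mcoeff f 0 = 1"
  shows "f * inverse f = 1"
proof -
  define h where "h = 1 - f"
  have h0: "mcoeff h 0 = 0" using assms by (simp add: h_def)
  define G where "G n = (\<Sum>k<Suc n. h ^ k)" for n
  define g :: "('v, 'a) mfps" where "g = Abs_mfps (\<lambda>\<mu>. mcoeff (G (mdegree \<mu>)) \<mu>)"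
  have mc_sum: "mcoeff (sum F A) \<nu> = (\<Sum>k\<in>A. mcoeff (F k) \<nu>)"
    for F :: "nat \<Rightarrow> ('v, 'a) mfps" and A \<nu>
    by (induction A rule: infinite_finite_induct) auto
  have G_eq: "mcoeff (G n) \<nu> = mcoeff g \<nu>" if "mdegree \<nu> \<le> n" for n \<nu>
    unfolding G_def g_def mc_sum mcoeff_Abs using that h0
    by (intro sum.mono_neutral_right) (auto intro!: mcoeff_power_eq_0)
  have "f * g = 1"
  proof (rule mfps_eqI)
    fix \<mu> :: "'v \<Rightarrow>\<^sub>0 nat"
    let ?n = "mdegree \<mu>"
    have "mcoeff (f * g) \<mu> = mcoeff (f * G ?n) \<mu>"
      unfolding mcoeff_mult by (rule sum.cong) (auto simp: G_eq mdegree_add)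
    also have "f * G ?n = 1 - h ^ Suc ?n"
      unfolding G_def by (subst one_diff_power_eq) (simp add: h_def)
    also have "mcoeff \<dots> \<mu> = mcoeff 1 \<mu>"
      using mcoeff_power_eq_0[OF h0, of \<mu> "Suc ?n"] by (simp del: power_Suc)
    finally show "mcoeff (f * g) \<mu> = mcoeff 1 \<mu>" .
  qed
  then show ?thesis
    using mfps_inverse_unique by blast
qed

definition mfps_X :: "'v \<Rightarrow> ('v, 'a::comm_ring_1) mfps" where
  "mfps_X v = Abs_mfps (\<lambda>\<mu>. if \<mu> = Poly_Mapping.single v 1 then 1 else 0)"

text \<open>\<open>(a; x)\<^sub>\<infinity>\<close>\<close>

definition qpoch_inf :: "('v, 'a::comm_ring_1) mfps \<Rightarrow> ('v, 'a) mfps \<Rightarrow> ('v, 'a) mfps" where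
  "qpoch_inf a x = prodinf (\<lambda>k. 1 - a * x ^ k)"


section \<open>The indeterminates\<close>

datatype indet = IQ nat | IC nat | ICbar nat

abbreviation vq :: "nat \<Rightarrow> (indet, 'a::comm_ring_1) mfps" where
  "vq i \<equiv> mfps_X (IQ i)"

abbreviation vc :: "nat \<Rightarrow> (indet, 'a::comm_ring_1) mfps" where
  "vc i \<equiv> mfps_X (IC i)"

abbreviation vcbar :: "nat \<Rightarrow> (indet, 'a::comm_ring_1) mfps" where
  "vcbar i \<equiv> mfps_X (ICbar i)"

text \<open>\<open>q\<^sub>0\<^sup>i q\<^sub>1 \<dots> q\<^sub>i\<close>\<close>

definition qmon :: "nat \<Rightarrow> (indet, 'a::comm_ring_1) mfps" where
  "qmon i = vq 0 ^ i * (\<Prod>k=1..i. vq k)"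


section \<open>Over-partitions\<close>

text \<open>
  \<open>Over i\<close> stands for the over-lined integer of size \<open>i\<close>. The value \<open>Over 0\<close> has no counterpart;
  it is excluded in the definition of over-partitions.
\<close>

datatype part = Plain nat | Over nat

fun psize :: "part \<Rightarrow> nat" where
  "psize (Plain i) = i"
| "psize (Over i) = i"

fun is_over :: "part \<Rightarrow> bool" where
  "is_over (Plain i) = False"
| "is_over (Over i) = True"

text \<open>\<open>Plain 0 < Over 1 < Plain 1 < Over 2 < Plain 2 < \<dots>\<close>\<close>

instantiation part :: linorder
begin

definition less_eq_part :: "part \<Rightarrow> part \<Rightarrow> bool" where
  "x \<le> y \<longleftrightarrow> psize x < psize y \<or> (psize x = psize y \<and> (is_over x \<or> \<not> is_over y))"

definition less_part :: "part \<Rightarrow> part \<Rightarrow> bool" where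
  "x < y \<longleftrightarrow> x \<le> y \<and> \<not> y \<le> (x :: part)"

instance
proof
  fix x y z :: part
  show "x < y \<longleftrightarrow> x \<le> y \<and> \<not> y \<le> x" by (simp add: less_part_def)
  show "x \<le> x" by (simp add: less_eq_part_def)
  show "x \<le> y \<Longrightarrow> y \<le> z \<Longrightarrow> x \<le> z" by (auto simp: less_eq_part_def)
  show "x \<le> y \<Longrightarrow> y \<le> x \<Longrightarrow> x = y" by (cases x; cases y) (auto simp: less_eq_part_def)
  show "x \<le> y \<or> y \<le> x" by (auto simp: less_eq_part_def)
qed

end

text \<open>
  A sequence \<open>(\<lambda>\<^sub>i)\<close>, \<open>i \<ge> 1\<close>, is stored as the function \<open>l\<close> with \<open>l i = \<lambda>\<^sub>i\<^sub>+\<^sub>1\<close>, so that functions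
  and sequences correspond one to one; \<open>part_at l i\<close> is \<open>\<lambda>\<^sub>i\<close> and is only used for \<open>i \<ge> 1\<close>.
\<close>

definition part_at :: "(nat \<Rightarrow> part) \<Rightarrow> nat \<Rightarrow> part" where
  "part_at l i = l (i - 1)"

definition sz :: "(nat \<Rightarrow> part) \<Rightarrow> nat \<Rightarrow> nat" where
  "sz l i = psize (part_at l i)"

definition ov :: "(nat \<Rightarrow> part) \<Rightarrow> nat \<Rightarrow> bool" where
  "ov l i \<longleftrightarrow> is_over (part_at l i)"

definition overpartition :: "(nat \<Rightarrow> part) \<Rightarrow> bool" where
  "overpartition l \<longleftrightarrow>
     (\<forall>i\<ge>1. part_at l i \<noteq> Over 0) \<and>
     (\<forall>i\<ge>1. part_at l (i + 1) \<le> part_at l i) \<and>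
     finite {i. i \<ge> 1 \<and> part_at l i \<noteq> Plain 0} \<and>
     (\<forall>i\<ge>1. \<forall>j\<ge>1. ov l i \<and> part_at l i = part_at l j \<longrightarrow> i = j)"

definition weight :: "(nat \<Rightarrow> part) \<Rightarrow> nat" where
  "weight l = Sum_any (\<lambda>i. sz l (i + 1))"

definition Pbar :: "nat \<Rightarrow> (nat \<Rightarrow> part) set" where
  "Pbar m = {l. overpartition l \<and> (\<forall>k\<ge>1. card {i. i \<ge> 1 \<and> part_at l i = Plain k} < m)}"

definition Pset :: "nat \<Rightarrow> (nat \<Rightarrow> part) set" where
  "Pset m = {l \<in> Pbar m. \<forall>i\<ge>1. \<not> ov l i}"

definition Fbar :: "nat \<Rightarrow> (nat \<Rightarrow> part) set" where
  "Fbar m = {l \<in> Pbar m. \<forall>i\<ge>1. \<not> m dvd i \<longrightarrow>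
     int (sz l i) - int (sz l (i + 1)) = of_bool (ov l i)}"

definition rho :: "nat \<Rightarrow> nat \<Rightarrow> (nat \<Rightarrow> part) \<Rightarrow> int" where
  "rho m j l = Sum_any (\<lambda>i. int (sz l (j + i * m)) - int (sz l (j + 1 + i * m))
                            - of_bool (ov l (j + i * m)))"

definition rho_bar :: "nat \<Rightarrow> nat \<Rightarrow> (nat \<Rightarrow> part) \<Rightarrow> nat" where
  "rho_bar m j l = card {i. ov l (j + i * m)}"

text \<open>\<open>\<lambda>\<^sub>i + \<lambda>\<^sub>i\<^sub>+\<^sub>m + \<lambda>\<^sub>i\<^sub>+\<^sub>2\<^sub>m + \<dots>\<close>\<close>

definition class_sum :: "nat \<Rightarrow> nat \<Rightarrow> (nat \<Rightarrow> part) \<Rightarrow> nat" where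
  "class_sum m i l = Sum_any (\<lambda>j. sz l (i + j * m))"

text \<open>All terms of \<open>rho\<close> are nonnegative, so \<open>nat (rho m j l)\<close> is a faithful exponent.\<close>

lemma rho_nonneg:
  assumes "overpartition l" "1 \<le> j"
  shows "rho m j l \<ge> 0"
proof -
  have "int (sz l i) - int (sz l (i + 1)) - of_bool (ov l i) \<ge> 0" if i: "i \<ge> 1" for i
  proof -
    have le: "part_at l (i + 1) \<le> part_at l i"
      using assms(1) i unfolding overpartition_def by blast
    have ne: "part_at l i \<noteq> part_at l (i + 1)" if "ov l i"
    proof
      assume "part_at l i = part_at l (i + 1)"
      moreover have "i + 1 \<ge> 1" by simp
      ultimately have "i = i + 1"
        using assms(1) i \<open>ov l i\<close> unfolding overpartition_def by blast
      then show False by simp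
    qed
    show ?thesis
      using le ne
      by (cases "part_at l i"; cases "part_at l (i + 1)")
         (auto simp: sz_def ov_def less_eq_part_def)
  qed
  from this[of "j + i * m" for i] show ?thesis
    using assms(2) unfolding rho_def Sum_any.expand_set
    by (intro sum_nonneg) (simp add: ac_simps)
qed

end

theory Submission
  imports Defs
begin

text \<open>
  Let \<open>P\<^sub>k\<close> be the number of parts of size at least \<open>k\<close>. The weight of an over-partition is the product
  over \<open>k \<ge> 1\<close> of a factor \<open>z(P\<^sub>k, b\<^sub>k)\<close>, where \<open>b\<^sub>k\<close> says whether \<open>k\<close> over-lined occurs, and
  \<open>z(P + m, b) = x z(P, b)\<close> with \<open>x = q\<^sub>0\<^sup>m q\<^sub>1 \<dots> q\<^sub>m\<close>. Without any bound on multiplicities, the pairs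
  \<open>(P\<^sub>k, b\<^sub>k)\<close> form a multiset in which those with \<open>b\<^sub>k\<close> true do not repeat, so the generating function is
  \<open>\<Prod>\<^sub>i (1 + z(i, True)) / (1 - z(i, False))\<close>. Requiring fewer than \<open>m\<close> plain parts of every size
  multiplies it by \<open>(x; x)\<^sub>\<infinity>\<close>, since \<open>m\<close> plain parts of size \<open>k\<close> contribute \<open>x\<^sup>k\<close>; this cancels the
  factors \<open>1 - z(i, False)\<close> with \<open>m dvd i\<close>. The other two identities are the specialisations
  \<open>c\<^sub>j = 0\<close> for over-lined, respectively plain, \<open>j\<close>. All limits are handled by truncating at a fixed
  total degree.
\<close>

section \<open>Power series modulo high degree\<close>

definition order_ge :: "nat \<Rightarrow> ('v, 'a::comm_ring_1) mfps \<Rightarrow> bool" where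
  "order_ge n f \<longleftrightarrow> (\<forall>\<mu>. mdegree \<mu> < n \<longrightarrow> mcoeff f \<mu> = 0)"

text \<open>Congruence modulo the ideal of series without monomials of degree below
  \<open>n\<close>. Comparing limits through it keeps the argument inside finite sums and
  products.\<close>

definition mcong :: "nat \<Rightarrow> ('v, 'a::comm_ring_1) mfps \<Rightarrow> ('v, 'a) mfps \<Rightarrow> bool" where
  "mcong n f g \<longleftrightarrow> order_ge n (f - g)"

lemma mcong_iff: "mcong n f g \<longleftrightarrow> (\<forall>\<mu>. mdegree \<mu> < n \<longrightarrow> mcoeff f \<mu> = mcoeff g \<mu>)"
  by (simp add: mcong_def order_ge_def)

lemma order_ge_iff_mcong_0: "order_ge n f \<longleftrightarrow> mcong n f 0"
  by (simp add: mcong_def)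

lemma order_ge_0 [simp]: "order_ge 0 f"
  by (simp add: order_ge_def)

lemma order_ge_zero [simp]: "order_ge n 0"
  by (simp add: order_ge_def)

lemma order_ge_mono: "order_ge n f \<Longrightarrow> m \<le> n \<Longrightarrow> order_ge m f"
  by (auto simp: order_ge_def)

lemma order_ge_add: "order_ge n f \<Longrightarrow> order_ge n g \<Longrightarrow> order_ge n (f + g)"
  by (simp add: order_ge_def)

lemma order_ge_sum: "(\<And>i. i \<in> A \<Longrightarrow> order_ge n (f i)) \<Longrightarrow> order_ge n (\<Sum>i\<in>A. f i)"
  by (induction A rule: infinite_finite_induct) (auto simp: order_ge_add)

lemma order_ge_mult:
  fixes f g :: "('v, 'a::comm_ring_1) mfps"
  assumes "order_ge a f" "order_ge b g"
  shows "order_ge (a + b) (f * g)"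
  unfolding order_ge_def
proof (intro allI impI)
  fix \<mu> :: "'v \<Rightarrow>\<^sub>0 nat" assume \<mu>: "mdegree \<mu> < a + b"
  have "mcoeff f \<alpha> * mcoeff g \<beta> = 0" if "\<alpha> + \<beta> = \<mu>" for \<alpha> \<beta>
  proof -
    have "mdegree \<alpha> < a \<or> mdegree \<beta> < b"
      using \<mu> that mdegree_add[of \<alpha> \<beta>] by auto
    then show ?thesis
      using assms by (auto simp: order_ge_def)
  qed
  then show "mcoeff (f * g) \<mu> = 0"
    by (auto simp: mcoeff_mult intro!: sum.neutral)
qed

lemma order_ge_mult_right: "order_ge n f \<Longrightarrow> order_ge n (f * g)"
  using order_ge_mult[of n f 0 g] by simp

lemma order_ge_mult_left: "order_ge n f \<Longrightarrow> order_ge n (g * f)"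
  using order_ge_mult_right[of n f g] by (simp add: mult.commute)

lemma order_ge_power: "order_ge 1 f \<Longrightarrow> order_ge n (f ^ n)"
proof (induction n)
  case (Suc n)
  then show ?case
    using order_ge_mult[of 1 f n "f ^ n"] by simp
qed simp

lemma order_ge_X [simp]: "order_ge 1 (mfps_X v)"
proof -
  have "mdegree (Poly_Mapping.single v 1) = 1"
    by (simp add: mdegree_def)
  then show ?thesis
    by (auto simp: order_ge_def mfps_X_def)
qed

lemma mcong_refl [simp]: "mcong n f f"
  by (simp add: mcong_iff)

lemma mcong_sym: "mcong n f g \<Longrightarrow> mcong n g f"
  by (simp add: mcong_iff)

lemma mcong_trans [trans]: "mcong n f g \<Longrightarrow> mcong n g h \<Longrightarrow> mcong n f h"
  by (simp add: mcong_iff)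

lemma mcong_mono: "mcong n f g \<Longrightarrow> m \<le> n \<Longrightarrow> mcong m f g"
  by (simp add: mcong_iff)

lemma mcong_add: "mcong n f f' \<Longrightarrow> mcong n g g' \<Longrightarrow> mcong n (f + g) (f' + g')"
  by (simp add: mcong_iff)

lemma mcong_diff: "mcong n f f' \<Longrightarrow> mcong n g g' \<Longrightarrow> mcong n (f - g) (f' - g')"
  by (simp add: mcong_iff)

lemma mcong_mult:
  assumes "mcong n f f'" "mcong n g g'"
  shows "mcong n (f * g) (f' * g')"
proof -
  have "f * g - f' * g' = (f - f') * g + f' * (g - g')"
    by (simp add: algebra_simps)
  then show ?thesis
    using assms unfolding mcong_def
    by (simp add: order_ge_add order_ge_mult_left order_ge_mult_right)
qed

lemma mcong_sum: "(\<And>i. i \<in> A \<Longrightarrow> mcong n (f i) (g i)) \<Longrightarrow> mcong n (\<Sum>i\<in>A. f i) (\<Sum>i\<in>A. g i)"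
  by (induction A rule: infinite_finite_induct) (auto simp: mcong_add)

lemma mcong_prod: "(\<And>i. i \<in> A \<Longrightarrow> mcong n (f i) (g i)) \<Longrightarrow> mcong n (\<Prod>i\<in>A. f i) (\<Prod>i\<in>A. g i)"
  by (induction A rule: infinite_finite_induct) (auto simp: mcong_mult)

lemma mcoeff_zero_eqI: "mcong 1 f g \<Longrightarrow> mcoeff f 0 = mcoeff g 0"
  by (simp add: mcong_iff mdegree_def)

text \<open>The factor \<open>1 - a * x ^ k\<close> affects only degrees above \<open>k\<close>,
  because \<open>a\<close> and \<open>x\<close> have no constant term. Later congruences use the
  infinite product only through this truncation.\<close>

lemma mcong_qpoch_inf:
  fixes a x :: "('v, 'a::comm_ring_1) mfps"
  assumes a: "order_ge 1 a" and x: "order_ge 1 x"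
  shows "mcong n (qpoch_inf a x) (\<Prod>k<n. 1 - a * x ^ k)"
proof -
  define p where "p n = (\<Prod>k<n. 1 - a * x ^ k)" for n
  have step: "mcong (Suc n) (p (Suc n)) (p n)" for n
  proof -
    have "order_ge (Suc n) (a * x ^ n)"
      using order_ge_mult[OF a order_ge_power[OF x, of n]] by simp
    then have "order_ge (Suc n) (p n * (a * x ^ n))"
      by (rule order_ge_mult_left)
    moreover have "p n - p (Suc n) = p n * (a * x ^ n)"
      by (simp add: p_def algebra_simps)
    ultimately have "mcong (Suc n) (p n) (p (Suc n))"
      by (simp add: mcong_def)
    then show ?thesis by (rule mcong_sym)
  qed
  have stab: "mcong n (p (n + d)) (p n)" for n d
  proof (induction d)
    case (Suc d)
    have "mcong n (p (Suc (n + d))) (p (n + d))"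
      using step by (rule mcong_mono) simp
    with Suc show ?case
      by (metis add_Suc_right mcong_trans)
  qed simp
  \<comment> \<open>Each coefficient of the limit is read off from a partial product in which it is
    already stable.\<close>
  define L where "L = Abs_mfps (\<lambda>\<mu>. mcoeff (p (Suc (mdegree \<mu>))) \<mu>)"
  have L: "mcong n (p n) L" for n
    unfolding mcong_iff
  proof (intro allI impI)
    fix \<mu> :: "'v \<Rightarrow>\<^sub>0 nat" assume "mdegree \<mu> < n"
    then obtain d where d: "n = Suc (mdegree \<mu>) + d"
      using less_iff_Suc_add[of "mdegree \<mu>" n] by auto
    show "mcoeff (p n) \<mu> = mcoeff L \<mu>"
      using stab[of "Suc (mdegree \<mu>)" d] unfolding d mcong_iff L_def by simp
  qed
  have lim: "(\<lambda>n. \<Prod>k\<le>n. 1 - a * x ^ k) \<longlonglongrightarrow> L"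
    unfolding tendsto_mfps_iff
  proof
    fix \<mu>
    have "mcoeff (\<Prod>k\<le>n. 1 - a * x ^ k) \<mu> = mcoeff L \<mu>" if "n \<ge> mdegree \<mu>" for n
      using L[of "Suc n"] that unfolding p_def mcong_iff lessThan_Suc_atMost by simp
    then show "\<forall>\<^sub>F n in sequentially. mcoeff (\<Prod>k\<le>n. 1 - a * x ^ k) \<mu> = mcoeff L \<mu>"
      unfolding eventually_sequentially by blast
  qed
  \<comment> \<open>\<open>has_prod\<close> also admits the value 0 for a product with a vanishing
    factor; excluding that case makes \<open>L\<close> the only possible value.\<close>
  have nz: "1 - a * x ^ k \<noteq> 0" for k
  proof
    assume eq: "1 - a * x ^ k = 0"
    have "order_ge 1 (a * x ^ k)"
      using a by (rule order_ge_mult_right)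
    then have "mcoeff (1 - a * x ^ k) 0 = 1"
      by (simp add: order_ge_def mdegree_def)
    with eq show False by simp
  qed
  have L0: "L \<noteq> 0"
  proof
    assume "L = 0"
    moreover have "mcong 1 (p 1) (p 0)"
      using step[of 0] by simp
    then have "mcoeff L 0 = 1"
      using mcoeff_zero_eqI by (fastforce simp: L_def mdegree_def p_def)
    ultimately show False by simp
  qed
  have raw: "raw_has_prod (\<lambda>k. 1 - a * x ^ k) 0 L"
    using lim L0 by (simp add: raw_has_prod_def)
  have "prodinf (\<lambda>k. 1 - a * x ^ k) = L"
    unfolding prodinf_def
  proof (rule the_equality)
    show "(\<lambda>k. 1 - a * x ^ k) has_prod L"
      using raw by (simp add: has_prod_def)
  next
    fix M assume "(\<lambda>k. 1 - a * x ^ k) has_prod M"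
    then have "raw_has_prod (\<lambda>k. 1 - a * x ^ k) 0 M"
      using nz by (auto simp: has_prod_def)
    then show "M = L"
      using lim by (auto simp: raw_has_prod_def intro: LIMSEQ_unique)
  qed
  then show ?thesis
    using L[of n] unfolding qpoch_inf_def p_def by (simp add: mcong_sym)
qed

lemma qpoch_inf_0 [simp]: "qpoch_inf 0 x = (1 :: ('v, 'a::comm_ring_1) mfps)"
proof (rule mfps_eqI)
  fix \<mu> :: "'v \<Rightarrow>\<^sub>0 nat"
  \<comment> \<open>The base \<open>x\<close> is arbitrary here, whereas the truncation needs a base
    of positive order; as \<open>a = 0\<close>, the base may be replaced by 0.\<close>
  have "(\<lambda>k::nat. 1 - 0 * x ^ k) = (\<lambda>k. 1 - 0 * (0 :: ('v, 'a) mfps) ^ k)"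
    by simp
  then have "qpoch_inf 0 x = qpoch_inf 0 (0 :: ('v, 'a) mfps)"
    unfolding qpoch_inf_def by metis
  then show "mcoeff (qpoch_inf 0 x) \<mu> = mcoeff (1 :: ('v, 'a) mfps) \<mu>"
    using mcong_qpoch_inf[of 0 "0 :: ('v, 'a) mfps" "Suc (mdegree \<mu>)"]
    by (simp add: mcong_iff del: mcoeff_simps(2))
qed

lemma mcoeff_qpoch_inf_0:
  fixes a x :: "('v, 'a::comm_ring_1) mfps"
  assumes "order_ge 1 a" "order_ge 1 x"
  shows "mcoeff (qpoch_inf a x) 0 = 1"
proof -
  have "mcoeff (qpoch_inf a x) 0 = mcoeff (\<Prod>k<1. 1 - a * x ^ k) 0"
    by (rule mcoeff_zero_eqI) (rule mcong_qpoch_inf[OF assms])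
  also have "\<dots> = 1"
    using assms by (simp add: order_ge_def mdegree_def)
  finally show ?thesis .
qed

lemma mfps_divide_mult_cancel:
  fixes f g :: "('v, 'a::comm_ring_1) mfps"
  assumes "mcoeff g 0 = 1"
  shows "f / g * g = f"
proof -
  have "f / g * g = f * (g * inverse g)"
    by (simp add: divide_mfps_def inverse_mfps_def mult_ac)
  then show ?thesis
    using mfps_right_inverse[OF assms] by simp
qed

lemma mfps_divide_1: "f / 1 = (f :: ('v, 'a::comm_ring_1) mfps)"
  using mfps_divide_mult_cancel[of 1 f] by simp

text \<open>Constant coefficient 1 makes \<open>h\<close> a unit, so cancellation is possible
  although the coefficient ring may have zero divisors.\<close>

lemma mcong_mult_cancel:
  fixes f g h :: "('v, 'a::comm_ring_1) mfps"
  assumes "mcong n (f * h) (g * h)" "mcoeff h 0 = 1"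
  shows "mcong n f g"
  using mcong_mult[OF assms(1) mcong_refl[of n "inverse h"]] mfps_right_inverse[OF assms(2)]
  by (simp add: mult.assoc)

section \<open>Level-by-level generating functions\<close>

text \<open>
  Sums over \<open>k\<close> further levels, in order of decreasing size, below a level at which \<open>P\<close> parts are present:
  \<open>path_sum\<close> allows up to \<open>N\<close> parts in total, \<open>bounded_path_sum\<close> adds fewer than \<open>m\<close> plain parts per level.
\<close>

primrec path_sum :: "(nat \<Rightarrow> bool \<Rightarrow> 'r::comm_ring_1) \<Rightarrow> nat \<Rightarrow> nat \<Rightarrow> nat \<Rightarrow> 'r" where
  "path_sum z N 0 P = 1"
| "path_sum z N (Suc k) P =
     (\<Sum>Q=P..N. z Q False * path_sum z N k Q) + (\<Sum>Q=Suc P..N. z Q True * path_sum z N k Q)"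

primrec bounded_path_sum :: "(nat \<Rightarrow> bool \<Rightarrow> 'r::comm_ring_1) \<Rightarrow> nat \<Rightarrow> nat \<Rightarrow> nat \<Rightarrow> 'r" where
  "bounded_path_sum z m 0 P = 1"
| "bounded_path_sum z m (Suc k) P =
     (\<Sum>n<m. z (P + n) False * bounded_path_sum z m k (P + n)
          + z (Suc (P + n)) True * bounded_path_sum z m k (Suc (P + n)))"

lemma path_sum_top: "path_sum z N k N = z N False ^ k"
  by (induction k) auto

text \<open>Paths correspond to multisets of pairs \<open>(Q, b)\<close> in which pairs with
  \<open>b\<close> true do not repeat. The summands collect those without \<open>Suc N\<close>,
  those containing \<open>(Suc N, False)\<close>, from which one copy is removed, and those in which
  \<open>Suc N\<close> occurs only as \<open>(Suc N, True)\<close>.\<close>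

lemma path_sum_rec:
  assumes "P \<le> N"
  shows "path_sum z (Suc N) (Suc k) P = path_sum z N (Suc k) P
    + z (Suc N) False * path_sum z (Suc N) k P + z (Suc N) True * path_sum z N k P"
  using assms
proof (induction k arbitrary: P)
  case 0
  then show ?case by (simp add: algebra_simps)
next
  case (Suc k)
  let ?z0 = "z (Suc N) False" and ?z1 = "z (Suc N) True"
  let ?A = "path_sum z (Suc N)" and ?A' = "path_sum z N"
  \<comment> \<open>Separating the terms with \<open>Q = Suc N\<close>, where
    \<open>path_sum_top\<close> gives a power of \<open>?z0\<close>, leaves sums to which the
    induction hypothesis applies.\<close>
  have split: "?A (Suc j) P = (\<Sum>Q=P..N. z Q False * ?A j Q) + (\<Sum>Q=Suc P..N. z Q True * ?A j Q)
      + (?z0 + ?z1) * ?z0 ^ j" for j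
    using Suc.prems by (simp add: path_sum_top algebra_simps)
  have IH0: "(\<Sum>Q=P..N. z Q False * ?A (Suc k) Q) = (\<Sum>Q=P..N. z Q False * ?A' (Suc k) Q)
      + ?z0 * (\<Sum>Q=P..N. z Q False * ?A k Q) + ?z1 * (\<Sum>Q=P..N. z Q False * ?A' k Q)"
    unfolding sum_distrib_left sum.distrib[symmetric]
    by (rule sum.cong) (simp_all add: Suc.IH algebra_simps del: path_sum.simps)
  have IH1: "(\<Sum>Q=Suc P..N. z Q True * ?A (Suc k) Q) = (\<Sum>Q=Suc P..N. z Q True * ?A' (Suc k) Q)
      + ?z0 * (\<Sum>Q=Suc P..N. z Q True * ?A k Q) + ?z1 * (\<Sum>Q=Suc P..N. z Q True * ?A' k Q)"
    unfolding sum_distrib_left sum.distrib[symmetric]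
    by (rule sum.cong) (simp_all add: Suc.IH algebra_simps del: path_sum.simps)
  show ?case
    unfolding split[of "Suc k"] split[of k] IH0 IH1
    unfolding path_sum.simps(2)[of z N "Suc k" P] path_sum.simps(2)[of z N k P]
    by (simp add: algebra_simps del: path_sum.simps)
qed

lemma path_sum_shift:
  assumes z: "\<And>P b. z (P + m) b = x * z P b"
  shows "path_sum z (N + m) k (P + m) = x ^ k * path_sum z N k P"
proof (induction k arbitrary: P)
  case (Suc k)
  have "(\<Sum>Q=P+m..N+m. z Q False * path_sum z (N + m) k Q)
      = x ^ Suc k * (\<Sum>Q=P..N. z Q False * path_sum z N k Q)"
    unfolding sum.shift_bounds_cl_nat_ivl sum_distrib_left
    by (rule sum.cong) (simp_all add: z Suc.IH algebra_simps)
  moreover have "(\<Sum>Q=Suc P+m..N+m. z Q True * path_sum z (N + m) k Q)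
      = x ^ Suc k * (\<Sum>Q=Suc P..N. z Q True * path_sum z N k Q)"
    unfolding sum.shift_bounds_cl_nat_ivl sum_distrib_left
    by (rule sum.cong) (simp_all add: z Suc.IH algebra_simps)
  ultimately show ?case
    by (simp add: algebra_simps)
qed simp

context
  fixes z :: "nat \<Rightarrow> bool \<Rightarrow> ('v, 'a::comm_ring_1) mfps"
  assumes ord: "\<And>P b. order_ge P (z P b)" and z0: "z 0 False = 1"
begin

text \<open>Counts never decrease along a path, so each of the \<open>k\<close> levels contributes
  degree at least 1.\<close>

lemma order_ge_path_sum: "P \<ge> 1 \<Longrightarrow> order_ge k (path_sum z N k P)"
proof (induction k arbitrary: P)
  case (Suc k)
  have "order_ge (Suc k) (z Q b * path_sum z N k Q)" if "Q \<ge> 1" for Q b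
    using order_ge_mult[OF order_ge_mono[OF ord that, of b] Suc.IH[OF that]] by simp
  then show ?case
    using Suc.prems by (auto intro!: order_ge_add order_ge_sum)
qed simp

lemma mcong_path_sum_Suc_level: "mcong (Suc k) (path_sum z N (Suc k) 0) (path_sum z N k 0)"
proof -
  have o: "order_ge (Suc k) (z Q b * path_sum z N k Q)" if "Q \<ge> 1" for Q b
    using order_ge_mult[OF order_ge_mono[OF ord that, of b] order_ge_path_sum[OF that]] by simp
  have eq: "path_sum z N (Suc k) 0 - path_sum z N k 0
     = (\<Sum>Q=1..N. z Q False * path_sum z N k Q) + (\<Sum>Q=1..N. z Q True * path_sum z N k Q)"
    by (simp add: sum.atLeast_Suc_atMost[of 0 N] z0)
  show ?thesis
    unfolding mcong_def eq using o by (auto intro!: order_ge_add order_ge_sum)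
qed

text \<open>Induction on \<open>N\<close> adds one factor to each product. In
  \<open>path_sum_rec\<close> at \<open>P = 0\<close>, the path sums with \<open>k - 1\<close>
  levels may be replaced by those with \<open>k\<close> levels modulo degree \<open>k\<close>, which
  turns the recurrence into a product rule.\<close>

lemma mcong_path_sum_prod:
  "mcong k (path_sum z N k 0 * (\<Prod>i=1..N. 1 - z i False)) (\<Prod>i=1..N. 1 + z i True)"
proof (induction N)
  case 0
  show ?case by (simp add: path_sum_top z0)
next
  case (Suc N)
  let ?U = "\<Prod>i=1..N. 1 - z i False"
  have step: "mcong k (path_sum z (Suc N) k 0 * (1 - z (Suc N) False))
          (path_sum z N k 0 * (1 + z (Suc N) True))"
  proof (cases k)
    case 0
    then show ?thesis by (simp add: mcong_def)
  next
    case (Suc j)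
    have "mcong k (path_sum z N k 0
        + z (Suc N) False * path_sum z (Suc N) j 0 + z (Suc N) True * path_sum z N j 0
        - path_sum z (Suc N) k 0 * z (Suc N) False)
       (path_sum z N k 0
        + z (Suc N) False * path_sum z (Suc N) k 0 + z (Suc N) True * path_sum z N k 0
        - path_sum z (Suc N) k 0 * z (Suc N) False)"
      unfolding Suc
      by (intro mcong_add mcong_diff mcong_mult mcong_refl mcong_sym[OF mcong_path_sum_Suc_level])
    moreover have "path_sum z (Suc N) k 0 * (1 - z (Suc N) False) = path_sum z N k 0
        + z (Suc N) False * path_sum z (Suc N) j 0 + z (Suc N) True * path_sum z N j 0
        - path_sum z (Suc N) k 0 * z (Suc N) False"
      using path_sum_rec[of 0 N z j] by (simp add: Suc algebra_simps del: path_sum.simps)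
    ultimately show ?thesis
      by (simp add: algebra_simps)
  qed
  have "mcong k (path_sum z (Suc N) k 0 * (1 - z (Suc N) False) * ?U)
        (path_sum z N k 0 * (1 + z (Suc N) True) * ?U)"
    by (intro mcong_mult step mcong_refl)
  also have "path_sum z N k 0 * (1 + z (Suc N) True) * ?U
      = path_sum z N k 0 * ?U * (1 + z (Suc N) True)"
    by (simp only: mult_ac)
  also have "mcong k \<dots> ((\<Prod>i=1..N. 1 + z i True) * (1 + z (Suc N) True))"
    by (intro mcong_mult Suc mcong_refl)
  finally show ?case
    by (simp add: mult_ac)
qed

text \<open>A path that reaches a count \<open>Q > N\<close> has a factor of order greater than
  \<open>N\<close>.\<close>

lemma mcong_path_sum_bound: "mcong N (path_sum z (N + d) k P) (path_sum z N k P)"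
proof (induction k arbitrary: P)
  case (Suc k)
  have *: "mcong N (\<Sum>Q=P..N+d. z Q b * path_sum z (N + d) k Q) (\<Sum>Q=P..N. z Q b * path_sum z N k Q)"
    for P b
  proof -
    have "mcong N (\<Sum>Q=P..N+d. z Q b * path_sum z (N + d) k Q)
        (\<Sum>Q=P..N+d. if Q \<le> N then z Q b * path_sum z N k Q else 0)"
    proof (rule mcong_sum)
      fix Q
      show "mcong N (z Q b * path_sum z (N + d) k Q) (if Q \<le> N then z Q b * path_sum z N k Q else 0)"
        using order_ge_mult_right[OF order_ge_mono[OF ord, of N Q b], of "path_sum z (N + d) k Q"]
        by (auto intro: mcong_mult Suc.IH simp: order_ge_iff_mcong_0)
    qed
    also have "(\<Sum>Q=P..N+d. if Q \<le> N then z Q b * path_sum z N k Q else 0)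
        = (\<Sum>Q=P..N. z Q b * path_sum z N k Q)"
      by (rule sum.mono_neutral_cong_right) auto
    finally show ?thesis .
  qed
  show ?case
    unfolding path_sum.simps by (intro mcong_add *)
qed simp

text \<open>
  Under the hypothesis on \<open>z\<close>, removing \<open>m\<close> of the plain parts of size \<open>k\<close> divides the weight by \<open>x\<^sup>k\<close>;
  so multiplying by \<open>1 - x\<^sup>k\<close> leaves the configurations with fewer than \<open>m\<close> plain parts of size \<open>k\<close>.
\<close>

lemma mcong_path_sum_bounded:
  assumes z: "\<And>P b. z (P + m) b = x * z P b" and "P + k * m \<le> N"
  shows "mcong N (path_sum z N k P * (\<Prod>i=1..k. 1 - x ^ i)) (bounded_path_sum z m k P)"
  using assms(2)
proof (induction k arbitrary: P)
  case (Suc k)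
  let ?D = "\<Prod>i=1..k. 1 - x ^ i"
  have range: "(\<Sum>Q=P..N+m. f Q) = (\<Sum>n<m. f (P + n)) + (\<Sum>Q=P+m..N+m. f Q)"
    if "P \<le> Suc N" for f :: "nat \<Rightarrow> ('v, 'a) mfps" and P
  proof -
    have "(\<Sum>Q=P..N+m. f Q) = (\<Sum>Q\<in>{P..<P+m} \<union> {P+m..N+m}. f Q)"
      using that by (intro sum.cong) auto
    also have "\<dots> = (\<Sum>Q\<in>{P..<P+m}. f Q) + (\<Sum>Q=P+m..N+m. f Q)"
      by (rule sum.union_disjoint) auto
    also have "(\<Sum>Q\<in>{P..<P+m}. f Q) = (\<Sum>n<m. f (P + n))"
      using sum.shift_bounds_nat_ivl[of f 0 P m] by (simp add: atLeast0LessThan add.commute)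
    finally show ?thesis .
  qed
  have P: "P \<le> Suc N" "Suc P \<le> Suc N"
    using Suc.prems by auto
  \<comment> \<open>By \<open>path_sum_shift\<close> the subtracted term is the path sum started at
    \<open>P + m\<close>; the difference keeps exactly the choices with \<open>n < m\<close> plain
    parts at the first level.\<close>
  have eq: "path_sum z (N + m) (Suc k) P - x ^ Suc k * path_sum z N (Suc k) P =
     (\<Sum>n<m. z (P + n) False * path_sum z (N + m) k (P + n)
          + z (Suc (P + n)) True * path_sum z (N + m) k (Suc (P + n)))"
    unfolding path_sum_shift[where z = z, OF z, symmetric]
    using range[OF P(1), of "\<lambda>Q. z Q False * path_sum z (N + m) k Q"]
      range[OF P(2), of "\<lambda>Q. z Q True * path_sum z (N + m) k Q"]
    by (simp add: sum.distrib)
  \<comment> \<open>Raising the bound to \<open>N + m\<close> is invisible modulo degree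
    \<open>N\<close> and makes both sums in the difference end at the same bound.\<close>
  have "mcong N (path_sum z N (Suc k) P * (1 - x ^ Suc k))
      (path_sum z (N + m) (Suc k) P - x ^ Suc k * path_sum z N (Suc k) P)"
    using mcong_diff[OF mcong_sym[OF mcong_path_sum_bound[of N m "Suc k" P]]
        mcong_refl[of N "x ^ Suc k * path_sum z N (Suc k) P"]]
    by (simp add: algebra_simps)
  also have "mcong N \<dots> (\<Sum>n<m. z (P + n) False * path_sum z N k (P + n)
          + z (Suc (P + n)) True * path_sum z N k (Suc (P + n)))"
    unfolding eq by (intro mcong_sum mcong_add mcong_mult mcong_refl mcong_path_sum_bound)
  finally have "mcong N (path_sum z N (Suc k) P * (1 - x ^ Suc k) * ?D)
      ((\<Sum>n<m. z (P + n) False * path_sum z N k (P + n)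
          + z (Suc (P + n)) True * path_sum z N k (Suc (P + n))) * ?D)"
    by (intro mcong_mult mcong_refl)
  also have "(\<Sum>n<m. z (P + n) False * path_sum z N k (P + n)
          + z (Suc (P + n)) True * path_sum z N k (Suc (P + n))) * ?D =
     (\<Sum>n<m. z (P + n) False * (path_sum z N k (P + n) * ?D)
          + z (Suc (P + n)) True * (path_sum z N k (Suc (P + n)) * ?D))"
    unfolding sum_distrib_right by (rule sum.cong) (simp_all add: algebra_simps)
  also have "mcong N \<dots> (bounded_path_sum z m (Suc k) P)"
    unfolding bounded_path_sum.simps
    \<comment> \<open>A level adds at most \<open>m\<close> parts, \<open>m - 1\<close> plain and
      one over-lined, so the hypothesis on \<open>N\<close> passes to the remaining \<open>k\<close>
      levels.\<close>
    using Suc.prems by (intro mcong_sum mcong_add mcong_mult mcong_refl Suc.IH) auto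
  finally show ?case
    by (simp add: mult_ac del: path_sum.simps bounded_path_sum.simps)
qed simp

end

section \<open>Building an over-partition from its lowest level\<close>

lemma psize_eq_0_iff: "x \<noteq> Over 0 \<Longrightarrow> psize x = 0 \<longleftrightarrow> x = Plain 0"
  by (cases x) auto

lemma part_eqI: "psize x = psize y \<Longrightarrow> is_over x = is_over y \<Longrightarrow> x = y"
  by (cases x; cases y) auto

lemma eq_Plain_iff: "x = Plain k \<longleftrightarrow> psize x = k \<and> \<not> is_over x"
  by (cases x) auto

lemma eq_Over_iff: "x = Over k \<longleftrightarrow> psize x = k \<and> is_over x"
  by (cases x) auto

lemma all_ge_1_iff: "(\<forall>i\<ge>1. Q i) \<longleftrightarrow> (\<forall>i. Q (Suc i))"
  by (metis One_nat_def Suc_le_D Suc_le_mono le0)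

lemma Collect_ge_1: "{i. i \<ge> 1 \<and> Q (i - 1)} = Suc ` {i. Q i}"
  by (auto simp: image_iff intro!: exI[of _ "_ - 1"])

text \<open>Since over-lined \<open>k\<close> lies just below plain \<open>k\<close>, whatever
  follows it without repetition has smaller size. One inequality therefore encodes monotonicity,
  uniqueness of over-lined parts and the absence of \<open>Over 0\<close>.\<close>

lemma overpartition_iff:
  "overpartition l \<longleftrightarrow> (\<forall>i. psize (l (Suc i)) + of_bool (is_over (l i)) \<le> psize (l i))
     \<and> finite {i. psize (l i) \<noteq> 0}" (is "_ \<longleftrightarrow> ?step \<and> ?fin")
proof -
  have fin: "finite {i. i \<ge> 1 \<and> part_at l i \<noteq> Plain 0} \<longleftrightarrow> finite {i. l i \<noteq> Plain 0}"
    unfolding part_at_def Collect_ge_1[of "\<lambda>i. l i \<noteq> Plain 0"]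
    by (rule finite_image_iff) simp
  have op: "overpartition l \<longleftrightarrow> (\<forall>i. l i \<noteq> Over 0) \<and> (\<forall>i. l (Suc i) \<le> l i)
      \<and> finite {i. l i \<noteq> Plain 0} \<and> (\<forall>i j. is_over (l i) \<and> l i = l j \<longrightarrow> i = j)"
    unfolding overpartition_def fin all_ge_1_iff by (simp add: part_at_def ov_def)
  show ?thesis
  proof
    assume "overpartition l"
    note l = this[unfolded op]
    have "psize (l (Suc i)) + of_bool (is_over (l i)) \<le> psize (l i)" for i
    proof -
      have "l (Suc i) \<le> l i" "is_over (l i) \<longrightarrow> l i \<noteq> l (Suc i)"
        using l by (auto, metis n_not_Suc_n)
      then show ?thesis
        by (cases "l i"; cases "l (Suc i)") (auto simp: less_eq_part_def)
    qed
    moreover have "{i. psize (l i) \<noteq> 0} \<subseteq> {i. l i \<noteq> Plain 0}"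
      by auto
    ultimately show "?step \<and> ?fin"
      using l finite_subset by blast
  next
    assume r: "?step \<and> ?fin"
    have st: "psize (l (Suc i)) + of_bool (is_over (l i)) \<le> psize (l i)" for i
      using r by blast
    have nz: "l i \<noteq> Over 0" for i
      using st[of i] by (auto simp: eq_Over_iff)
    have anti: "psize (l j) \<le> psize (l i)" if "i \<le> j" for i j
      using that by (rule lift_Suc_antimono_le[of "\<lambda>i. psize (l i)", rotated]) (rule add_leD1[OF st])
    have strict: "psize (l j) < psize (l i)" if "is_over (l i)" "i < j" for i j
      using st[of i] anti[of "Suc i" j] that by simp
    have uniq: "i = j" if "is_over (l i)" "l i = l j" for i j
      using strict[of i j] strict[of j i] that by (cases i j rule: linorder_cases) auto
    have "l (Suc i) \<le> l i" for i
      using st[of i] by (auto simp: less_eq_part_def split: if_splits)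
    moreover have "{i. l i \<noteq> Plain 0} = {i. psize (l i) \<noteq> 0}"
      using psize_eq_0_iff[OF nz] by auto
    ultimately show "overpartition l"
      using nz r uniq unfolding op by auto
  qed
qed

lemma Pbar_iff: "l \<in> Pbar m \<longleftrightarrow> overpartition l \<and> (\<forall>k\<ge>1. card {i. l i = Plain k} < m)"
proof -
  have "card {i. i \<ge> 1 \<and> part_at l i = Plain k} = card {i. l i = Plain k}" for k
    unfolding part_at_def Collect_ge_1[of "\<lambda>i. l i = Plain k"] by (rule card_image) simp
  then show ?thesis
    by (simp add: Pbar_def)
qed

text \<open>Because sizes are non-increasing, this is the number of nonzero parts of an
  over-partition.\<close>

definition nparts :: "(nat \<Rightarrow> part) \<Rightarrow> nat" where
  "nparts l = (LEAST P. psize (l P) = 0)"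

lemma nparts_eqI: "(\<And>i. psize (l i) \<noteq> 0 \<longleftrightarrow> i < P) \<Longrightarrow> nparts l = P"
  unfolding nparts_def by (rule Least_equality) (blast, metis not_less)

context
  fixes l :: "nat \<Rightarrow> part"
  assumes l: "overpartition l"
begin

lemma overpartition_step: "psize (l (Suc i)) + of_bool (is_over (l i)) \<le> psize (l i)"
  using l by (simp add: overpartition_iff)

lemma overpartition_antimono: "i \<le> j \<Longrightarrow> psize (l j) \<le> psize (l i)"
  by (rule lift_Suc_antimono_le[of "\<lambda>i. psize (l i)"]) (rule add_leD1[OF overpartition_step])

lemma psize_pos_iff: "psize (l i) \<noteq> 0 \<longleftrightarrow> i < nparts l"
proof -
  have "finite {i. psize (l i) \<noteq> 0}"
    using l by (simp add: overpartition_iff)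
  then have "\<exists>P. psize (l P) = 0"
    using infinite_UNIV_nat by (metis (mono_tags, lifting) UNIV_eq_I mem_Collect_eq)
  then have "psize (l (nparts l)) = 0"
    unfolding nparts_def by (rule LeastI_ex)
  then show ?thesis
    using overpartition_antimono[of "nparts l" i] not_less_Least[of i "\<lambda>P. psize (l P) = 0"]
    unfolding nparts_def by (metis le_zero_eq not_le)
qed

lemma overpartition_over_pos: "is_over (l i) \<Longrightarrow> i < nparts l"
  using overpartition_step[of i] psize_pos_iff[of i] by simp

end

section \<open>Inserting and removing the lowest level\<close>

fun psuc :: "part \<Rightarrow> part" where
  "psuc (Plain k) = Plain (Suc k)"
| "psuc (Over k) = Over (Suc k)"

lemma psuc_simps [simp]: "psize (psuc x) = Suc (psize x)" "is_over (psuc x) = is_over x"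
  by (cases x; simp)+

text \<open>\<open>Over 1\<close> becomes \<open>Plain 0\<close>, since \<open>Over 0\<close> is
  excluded; the lost over-line has to be recorded separately.\<close>

fun ppred :: "part \<Rightarrow> part" where
  "ppred (Plain k) = Plain (k - 1)"
| "ppred (Over k) = (if k \<le> 1 then Plain 0 else Over (k - 1))"

lemma ppred_simps [simp]:
  "psize (ppred x) = psize x - 1" "is_over (ppred x) \<longleftrightarrow> is_over x \<and> psize x \<ge> 2"
  by (cases x; auto)+

text \<open>Existing levels move up by one size, and a new level of size 1 with
  \<open>nparts l + n + of_bool b\<close> parts appears below them. The over-lined 1 stands last
  because it is smaller than \<open>Plain 1\<close>.\<close>

definition add_level :: "(nat \<Rightarrow> part) \<Rightarrow> nat \<Rightarrow> bool \<Rightarrow> nat \<Rightarrow> part" where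
  "add_level l n b i = (if i < nparts l then psuc (l i) else if i < nparts l + n then Plain 1
     else if i = nparts l + n \<and> b then Over 1 else Plain 0)"

definition Pbar_upto :: "nat \<Rightarrow> nat \<Rightarrow> (nat \<Rightarrow> part) set" where
  "Pbar_upto m K = {l \<in> Pbar m. \<forall>i. psize (l i) \<le> K}"

context
  fixes l :: "nat \<Rightarrow> part"
  assumes l: "overpartition l"
begin

lemma psize_add_level: "psize (add_level l n b i) = psize (l i) + of_bool (i < nparts l + n + of_bool b)"
  using psize_pos_iff[OF l, of i] by (auto simp: add_level_def)

lemma is_over_add_level: "is_over (add_level l n b i) \<longleftrightarrow> is_over (l i) \<or> b \<and> i = nparts l + n"
  using overpartition_over_pos[OF l, of i] by (auto simp: add_level_def)

lemma nparts_add_level: "nparts (add_level l n b) = nparts l + n + of_bool b"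
proof (rule nparts_eqI)
  fix i
  show "psize (add_level l n b i) \<noteq> 0 \<longleftrightarrow> i < nparts l + n + of_bool b"
    using psize_pos_iff[OF l, of i] by (auto simp: psize_add_level)
qed

lemma overpartition_add_level: "overpartition (add_level l n b)"
  unfolding overpartition_iff
proof
  have "psize (add_level l n b i) \<noteq> 0 \<Longrightarrow> i < nparts l + n + of_bool b" for i
    using psize_pos_iff[OF l, of i] by (auto simp: psize_add_level split: if_splits)
  then have "{i. psize (add_level l n b i) \<noteq> 0} \<subseteq> {..<nparts l + n + of_bool b}"
    by blast
  then show "finite {i. psize (add_level l n b i) \<noteq> 0}"
    by (rule finite_subset) simp
  show "\<forall>i. psize (add_level l n b (Suc i)) + of_bool (is_over (add_level l n b i))
      \<le> psize (add_level l n b i)"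
  proof
    fix i
    show "psize (add_level l n b (Suc i)) + of_bool (is_over (add_level l n b i))
      \<le> psize (add_level l n b i)"
      using overpartition_step[OF l, of i] overpartition_over_pos[OF l, of i]
        psize_pos_iff[OF l, of "Suc i"]
      by (auto simp: psize_add_level is_over_add_level)
  qed
qed

lemma add_level_eq_Plain_1_iff:
  "add_level l n b i = Plain 1 \<longleftrightarrow> nparts l \<le> i \<and> i < nparts l + n"
  using psize_pos_iff[OF l, of i] overpartition_over_pos[OF l, of i]
  by (auto simp: eq_Plain_iff psize_add_level is_over_add_level)

lemma add_level_eq_Plain_iff:
  "k \<ge> 1 \<Longrightarrow> add_level l n b i = Plain (Suc k) \<longleftrightarrow> l i = Plain k"
  using psize_pos_iff[OF l, of i]
  by (auto simp: eq_Plain_iff psize_add_level is_over_add_level)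

lemma add_level_eq_Over_1_iff: "add_level l n b i = Over 1 \<longleftrightarrow> b \<and> i = nparts l + n"
  using psize_pos_iff[OF l, of i] overpartition_over_pos[OF l, of i]
  by (auto simp: eq_Over_iff psize_add_level is_over_add_level)

lemma ppred_add_level: "ppred (add_level l n b i) = l i"
  using psize_pos_iff[OF l, of i] overpartition_over_pos[OF l, of i]
  by (intro part_eqI) (auto simp: psize_add_level is_over_add_level)

lemma overpartition_ppred: "overpartition (\<lambda>i. ppred (l i))"
  unfolding overpartition_iff
proof
  have fin: "finite {i. psize (l i) \<noteq> 0}"
    using l by (simp add: overpartition_iff)
  show "finite {i. psize (ppred (l i)) \<noteq> 0}"
    by (rule finite_subset[OF _ fin]) auto
  show "\<forall>i. psize (ppred (l (Suc i))) + of_bool (is_over (ppred (l i))) \<le> psize (ppred (l i))"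
  proof
    fix i
    show "psize (ppred (l (Suc i))) + of_bool (is_over (ppred (l i))) \<le> psize (ppred (l i))"
      using overpartition_step[OF l, of i] by (auto split: if_splits)
  qed
qed

end

text \<open>Lowering every part by 1 loses only the parts of size 1, and these are determined by the
  number of plain ones and the presence of the over-lined one.\<close>

lemma add_level_ppred:
  assumes l: "overpartition l"
  shows "add_level (\<lambda>i. ppred (l i)) (card {i. l i = Plain 1}) (\<exists>i. l i = Over 1) = l"
    (is "add_level ?l ?n ?b = l")
proof -
  have pos: "i < nparts ?l \<longleftrightarrow> psize (l i) \<ge> 2" for i
    using psize_pos_iff[OF overpartition_ppred[OF l], of i] by auto
  have total_over: "nparts ?l + ?n + of_bool ?b = nparts l \<and> (?b \<longrightarrow> l (nparts ?l + ?n) = Over 1)"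
  proof -
    have le: "nparts ?l \<le> nparts l"
      using pos[of "nparts l"] psize_pos_iff[OF l, of "nparts l"] by auto
    show ?thesis
    proof (cases ?b)
      case False
      have "l i = Plain 1 \<longleftrightarrow> nparts ?l \<le> i \<and> i < nparts l" for i
        using pos[of i] psize_pos_iff[OF l, of i] False
        by (auto simp: eq_Plain_iff eq_Over_iff)
      then have "{i. l i = Plain 1} = {nparts ?l..<nparts l}"
        unfolding set_eq_iff by simp
      then show ?thesis
        using le False by simp
    next
      case True
      then obtain i where i: "l i = Over 1" by blast
      \<comment> \<open>An over-lined 1 forces the next size down to 0, hence is the last nonzero
        part.\<close>
      have "psize (l (Suc i)) = 0"
        using overpartition_step[OF l, of i] i by simp
      then have P: "nparts l = Suc i"
        using psize_pos_iff[OF l, of i] psize_pos_iff[OF l, of "Suc i"] i by simp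
      have ge: "nparts ?l \<le> i"
        using pos[of i] i by simp
      have "l j = Plain 1 \<longleftrightarrow> nparts ?l \<le> j \<and> j < i" for j
      proof -
        have "psize (l j) \<noteq> 0 \<longleftrightarrow> j \<le> i" "psize (l j) \<ge> 2 \<longleftrightarrow> j < nparts ?l"
          using pos[of j] psize_pos_iff[OF l, of j] P by auto
        moreover have "is_over (l j) \<Longrightarrow> psize (l j) = 1 \<Longrightarrow> j \<ge> i"
          using overpartition_step[OF l, of j] psize_pos_iff[OF l, of "Suc j"] P by auto
        ultimately show ?thesis
          using i by (auto simp: eq_Plain_iff le_less)
      qed
      then have "{j. l j = Plain 1} = {nparts ?l..<i}"
        unfolding set_eq_iff by simp
      then show ?thesis
        using True ge P i by auto
    qed
  qed
  show ?thesis
  proof (rule ext, rule part_eqI)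
    fix i
    show "psize (add_level ?l ?n ?b i) = psize (l i)"
    proof -
      have "psize (add_level ?l ?n ?b i) = psize (l i) - 1 + of_bool (i < nparts l)"
        using total_over by (simp only: psize_add_level[OF overpartition_ppred[OF l]] ppred_simps)
      then show ?thesis
        using psize_pos_iff[OF l, of i] by auto
    qed
    show "is_over (add_level ?l ?n ?b i) = is_over (l i)"
    proof -
      have eq: "is_over (add_level ?l ?n ?b i)
          \<longleftrightarrow> (is_over (l i) \<and> psize (l i) \<ge> 2) \<or> (?b \<and> i = nparts ?l + ?n)"
        by (simp only: is_over_add_level[OF overpartition_ppred[OF l]] ppred_simps)
      have "is_over (l i)" if "?b" "i = nparts ?l + ?n"
      proof -
        have "l (nparts ?l + ?n) = Over 1"
          using total_over that(1) by blast
        then show ?thesis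
          unfolding that(2) by simp
      qed
      moreover have "i = nparts ?l + ?n \<and> ?b" if "is_over (l i)" "\<not> psize (l i) \<ge> 2"
      proof -
        have i: "l i = Over 1"
          using that overpartition_step[OF l, of i] by (auto simp: eq_Over_iff)
        then have P: "nparts l = Suc i"
          using psize_pos_iff[OF l, of i] psize_pos_iff[OF l, of "Suc i"]
            overpartition_step[OF l, of i] by simp
        have b: ?b
          using i by blast
        then have "of_bool ?b = (1 :: nat)"
          by (simp only: of_bool_eq)
        then have "i = nparts ?l + ?n"
          using total_over P by linarith
        then show ?thesis
          using b ..
      qed
      ultimately show ?thesis
        unfolding eq by blast
    qed
  qed
qed

section \<open>Enumeration by the largest allowed size\<close>

lemma overpartition_Plain_0: "overpartition (\<lambda>_. Plain 0)"
  by (simp add: overpartition_iff)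

lemma Pbar_upto_0: "m \<ge> 1 \<Longrightarrow> Pbar_upto m 0 = {\<lambda>_. Plain 0}"
proof -
  assume m: "m \<ge> 1"
  have "l = (\<lambda>_. Plain 0)" if l: "l \<in> Pbar_upto m 0" for l
  proof
    fix i
    have "overpartition l" "psize (l i) = 0"
      using l by (simp_all add: Pbar_upto_def Pbar_iff)
    then show "l i = Plain 0"
      using overpartition_step[of l i] by (simp add: eq_Plain_iff)
  qed
  moreover have "(\<lambda>_. Plain 0) \<in> Pbar_upto m 0"
    using m overpartition_Plain_0 by (simp add: Pbar_upto_def Pbar_iff)
  ultimately show ?thesis
    by blast
qed

text \<open>The inverse lowers every part by 1 and records how many plain 1s there were and whether
  an over-lined 1 occurred. The range of \<open>n\<close> reflects the multiplicity bound at size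
  1.\<close>

lemma bij_betw_add_level:
  "bij_betw (\<lambda>(l, n, b). add_level l n b) (Pbar_upto m K \<times> {..<m} \<times> UNIV) (Pbar_upto m (Suc K))"
proof -
  define f where "f = (\<lambda>(l, n, b). add_level l n b)"
  define g where "g = (\<lambda>l :: nat \<Rightarrow> part.
    (\<lambda>i. ppred (l i), card {i. l i = Plain 1}, \<exists>i. l i = Over 1))"
  have "add_level l n b \<in> Pbar_upto m (Suc K)" if l: "l \<in> Pbar_upto m K" and n: "n < m" for l n b
  proof -
    have ol: "overpartition l"
      using l by (simp add: Pbar_upto_def Pbar_iff)
    have "card {i. add_level l n b i = Plain k} < m" if "k \<ge> 1" for k
    proof (cases "k = 1")
      case True
      have "{i. add_level l n b i = Plain 1} = {nparts l..<nparts l + n}"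
        unfolding add_level_eq_Plain_1_iff[OF ol] by auto
      then show ?thesis
        using n True by simp
    next
      case False
      then have k: "Suc (k - 1) = k" "k - 1 \<ge> 1"
        using that by auto
      show ?thesis
        using l k(2) add_level_eq_Plain_iff[OF ol k(2), of n b] unfolding k(1)
        by (simp add: Pbar_upto_def Pbar_iff)
    qed
    moreover have "psize (add_level l n b i) \<le> Suc K" for i
      using l by (auto simp: psize_add_level[OF ol] Pbar_upto_def intro: le_SucI)
    ultimately show ?thesis
      using overpartition_add_level[OF ol] by (simp add: Pbar_upto_def Pbar_iff)
  qed
  then have f: "f \<in> Pbar_upto m K \<times> {..<m} \<times> UNIV \<rightarrow> Pbar_upto m (Suc K)"
    by (auto simp: f_def)
  have "(\<lambda>i. ppred (l i)) \<in> Pbar_upto m K" if l: "l \<in> Pbar_upto m (Suc K)" for l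
  proof -
    have "ppred x = Plain k \<longleftrightarrow> x = Plain (Suc k)" if "k \<ge> 1" for x k
      using that by (cases x) auto
    then show ?thesis
      using l overpartition_ppred[of l] by (auto simp: Pbar_upto_def Pbar_iff le_diff_conv)
  qed
  then have g: "g \<in> Pbar_upto m (Suc K) \<rightarrow> Pbar_upto m K \<times> {..<m} \<times> UNIV"
    by (auto simp: g_def Pbar_upto_def Pbar_iff)
  have gf: "g (f p) = p"
    if "p \<in> Pbar_upto m K \<times> {..<m} \<times> UNIV" for p
  proof -
    obtain l n b where p: "p = (l, n, b)"
      by (cases p)
    have ol: "overpartition l"
      using that by (simp add: p Pbar_upto_def Pbar_iff)
    have "{i. nparts l \<le> i \<and> i < nparts l + n} = {nparts l..<nparts l + n}"
      by auto
    then show ?thesis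
      unfolding p f_def g_def by (simp only: prod.case ppred_add_level[OF ol] add_level_eq_Plain_1_iff[OF ol]
          add_level_eq_Over_1_iff[OF ol]) simp
  qed
  have fg: "f (g l) = l" if "l \<in> Pbar_upto m (Suc K)" for l
    using add_level_ppred[of l] that by (simp add: f_def g_def Pbar_upto_def Pbar_iff)
  show ?thesis
    using bij_betwI[OF f g gf fg] unfolding f_def .
qed

lemma finite_Pbar_upto: "m \<ge> 1 \<Longrightarrow> finite (Pbar_upto m K)"
proof (induction K)
  case (Suc K)
  then show ?case
    using bij_betw_finite[OF bij_betw_add_level[of m K]] by simp
qed (simp add: Pbar_upto_0)

lemma sum_Pbar_upto:
  fixes W :: "(nat \<Rightarrow> part) \<Rightarrow> 'r::comm_ring_1"
  assumes m: "m \<ge> 1" and W0: "W (\<lambda>_. Plain 0) = 1"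
    and W: "\<And>l n b. overpartition l \<Longrightarrow>
      W (add_level l n b) = W l * z (nparts l + n + of_bool b) b"
  shows "(\<Sum>l\<in>Pbar_upto m K. W l) = bounded_path_sum z m K 0"
proof -
  \<comment> \<open>Generalised for the induction: \<open>j\<close> levels are explicit in
    \<open>l\<close>, while \<open>bounded_path_sum\<close> accounts for \<open>k\<close> levels
    still to be put below them. The claim is the case \<open>k = 0\<close>.\<close>
  have "(\<Sum>l\<in>Pbar_upto m j. W l * bounded_path_sum z m k (nparts l)) = bounded_path_sum z m (j + k) 0"
    for j k
  proof (induction j arbitrary: k)
    case 0
    have "nparts (\<lambda>_. Plain 0) = 0"
      by (rule nparts_eqI) simp
    then show ?case
      by (simp add: Pbar_upto_0[OF m] W0)
  next
    case (Suc j)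
    let ?B = "bounded_path_sum z m"
    have "(\<Sum>l\<in>Pbar_upto m (Suc j). W l * ?B k (nparts l))
        = (\<Sum>(l, n, b)\<in>Pbar_upto m j \<times> {..<m} \<times> UNIV.
            W (add_level l n b) * ?B k (nparts (add_level l n b)))"
      by (subst sum.reindex_bij_betw[OF bij_betw_add_level, symmetric]) (simp add: case_prod_unfold)
    also have "\<dots> = (\<Sum>l\<in>Pbar_upto m j. \<Sum>n<m. \<Sum>b\<in>UNIV.
            W (add_level l n b) * ?B k (nparts (add_level l n b)))"
      by (simp only: sum.cartesian_product)
    also have "\<dots> = (\<Sum>l\<in>Pbar_upto m j. W l * ?B (Suc k) (nparts l))"
    proof (rule sum.cong[OF refl])
      fix l assume "l \<in> Pbar_upto m j"
      then have l: "overpartition l"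
        by (simp add: Pbar_upto_def Pbar_iff)
      show "(\<Sum>n<m. \<Sum>b\<in>UNIV. W (add_level l n b) * ?B k (nparts (add_level l n b)))
          = W l * ?B (Suc k) (nparts l)"
        unfolding bounded_path_sum.simps sum_distrib_left
        by (rule sum.cong[OF refl])
          (simp add: UNIV_bool W[OF l] nparts_add_level[OF l] algebra_simps)
    qed
    also have "\<dots> = ?B (Suc j + k) 0"
      using Suc[of "Suc k"] by simp
    finally show ?case .
  qed
  from this[of 0 K] show ?thesis by simp
qed

section \<open>The weight of an over-partition\<close>

lemma Sum_any_add_of_bool:
  fixes f :: "'i \<Rightarrow> 'b::semiring_1"
  assumes "finite {i. f i \<noteq> 0}" "finite {i. Q i}"
  shows "Sum_any (\<lambda>i. f i + of_bool (Q i)) = Sum_any f + of_nat (card {i. Q i})"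
proof -
  have "Sum_any (\<lambda>i. f i + of_bool (Q i)) = Sum_any f + Sum_any (\<lambda>i. of_bool (Q i))"
    by (rule Sum_any.distrib) (use assms in auto)
  also have "Sum_any (\<lambda>i. of_bool (Q i) :: 'b) = (\<Sum>i\<in>{i. Q i}. of_bool (Q i))"
    by (rule Sum_any.expand_superset) (use assms in auto)
  finally show ?thesis
    by simp
qed

lemma residue_progression_iff:
  fixes m :: nat
  assumes "1 \<le> j" "j < m"
  shows "(\<exists>i. j + i * m = P) \<longleftrightarrow> P mod m = j"
proof
  assume "P mod m = j"
  then have "j + (P div m) * m = P"
    by (metis mod_div_mult_eq)
  then show "\<exists>i. j + i * m = P" ..
qed (use assms in auto)

lemma multiple_progression_iff: "(\<exists>i. m + i * m = P) \<longleftrightarrow> P \<ge> 1 \<and> m dvd P" if "m \<ge> 1" for m P :: nat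
proof
  assume P: "P \<ge> 1 \<and> m dvd P"
  then obtain c where c: "P = m * c"
    by (auto elim: dvdE)
  with P obtain i where "c = Suc i"
    by (cases c) auto
  with c have "m + i * m = P"
    by simp
  then show "\<exists>i. m + i * m = P" ..
qed (use that in auto)

lemma finite_progression:
  fixes m :: nat
  assumes "m \<ge> 1"
  shows "finite {i. j + i * m \<le> P}" "finite {i. j + i * m = P \<and> c}"
proof -
  have "i \<le> P" if "j + i * m \<le> P" for i
  proof -
    have "i \<le> i * m"
      using assms by simp
    with that show ?thesis by linarith
  qed
  then have "{i. j + i * m \<le> P} \<subseteq> {..P}"
    by blast
  then show fin: "finite {i. j + i * m \<le> P}"
    by (rule finite_subset) simp
  show "finite {i. j + i * m = P \<and> c}"
    by (rule finite_subset[OF _ fin]) auto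
qed

lemma card_progression_eq:
  fixes m :: nat
  assumes "m \<ge> 1"
  shows "card {i. j + i * m = P \<and> c} = of_bool ((\<exists>i. j + i * m = P) \<and> c)"
proof (cases "(\<exists>i. j + i * m = P) \<and> c")
  case True
  then obtain i where i: "j + i * m = P" and c by blast
  then have "{i. j + i * m = P \<and> c} = {i}"
    using assms by auto
  then show ?thesis
    using True by simp
qed auto

text \<open>The part of the weight of a level with \<open>P\<close> parts that involves the
  \<open>q\<close> indeterminates. Index \<open>i\<close> stands for position \<open>i + 1\<close>,
  whose residue class has the representative \<open>Suc (i mod m)\<close> in
  \<open>1..m\<close>.\<close>

definition level_monomial :: "nat \<Rightarrow> nat \<Rightarrow> (indet, 'a::comm_ring_1) mfps" where
  "level_monomial m P = (\<Prod>i<P. vq 0 * vq (Suc (i mod m)))"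

lemma level_monomial_add_mult:
  "(level_monomial m (P + k * m) :: (indet, 'a::comm_ring_1) mfps)
     = level_monomial m m ^ k * level_monomial m P" (is "?L (P + k * m) = _")
proof -
  have one: "?L (P + m) = ?L m * ?L P" for P
    unfolding level_monomial_def
    by (induction P) (simp_all add: mult_ac)
  show ?thesis
  proof (induction k)
    case (Suc k)
    have "?L (P + Suc k * m) = ?L ((P + k * m) + m)"
      by (simp add: algebra_simps)
    also have "\<dots> = ?L m ^ Suc k * ?L P"
      unfolding one Suc by (simp add: mult_ac)
    finally show ?case .
  qed simp
qed

lemma level_monomial_eq_qmon: "j \<le> m \<Longrightarrow> level_monomial m j = qmon j"
  by (simp add: level_monomial_def qmon_def prod.distrib prod.atLeast1_atMost_eq)

text \<open>Grouping the factors by residue class turns the exponents into the increments of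
  \<open>class_sum\<close> caused by a level.\<close>

lemma level_monomial_eq_prod:
  assumes m: "m \<ge> 1"
  shows "level_monomial m P
    = (vq 0 ^ P * (\<Prod>i=1..m. vq i ^ card {j. i + j * m \<le> P}) :: (indet, 'a::comm_ring_1) mfps)"
proof (induction P)
  case 0
  then show ?case by (auto simp: level_monomial_def intro!: prod.neutral)
next
  case (Suc P)
  let ?r = "Suc (P mod m)"
  have "card {j. i + j * m \<le> Suc P} = card {j. i + j * m \<le> P} + of_bool (?r = i)"
    if i: "i \<in> {1..m}" for i
  proof -
    have ex: "(\<exists>j. i + j * m = Suc P) \<longleftrightarrow> ?r = i"
    proof
      assume "?r = i"
      then have "i + P div m * m = Suc P"
        by (metis add_Suc mod_div_mult_eq)
      then show "\<exists>j. i + j * m = Suc P" ..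
    next
      assume "\<exists>j. i + j * m = Suc P"
      then obtain j where "i + j * m = Suc P"
        by blast
      then have P: "P = (i - 1) + j * m"
        using i by simp
      have "((i - 1) + j * m) mod m = (i - 1) mod m"
        by (rule mod_mult_self1)
      also have "(i - 1) mod m = i - 1"
        using i by (intro mod_less) auto
      finally have "P mod m = i - 1"
        unfolding P .
      then show "?r = i"
        using i by simp
    qed
    have "{j. i + j * m \<le> Suc P} = {j. i + j * m \<le> P} \<union> {j. i + j * m = Suc P \<and> True}"
      by (auto simp: le_Suc_eq)
    also have "card \<dots> = card {j. i + j * m \<le> P} + card {j. i + j * m = Suc P \<and> True}"
      by (rule card_Un_disjoint)
        (use finite_progression(1)[OF m, of i P] finite_progression(2)[OF m, of i "Suc P" True] in auto)
    finally show ?thesis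
      unfolding card_progression_eq[OF m] ex by simp
  qed
  then have "((\<Prod>i=1..m. vq i ^ card {j. i + j * m \<le> Suc P}) :: (indet, 'a) mfps)
      = (\<Prod>i=1..m. vq i ^ card {j. i + j * m \<le> P} * (if ?r = i then vq i else 1))"
    by (intro prod.cong) (auto simp: power_add)
  also have "\<dots> = (\<Prod>i=1..m. vq i ^ card {j. i + j * m \<le> P}) * vq ?r"
    using m by (simp add: prod.distrib prod.delta' Suc_leI)
  finally show ?case
    using Suc by (simp add: level_monomial_def mult_ac)
qed

lemma order_ge_level_monomial: "order_ge P (level_monomial m P :: (indet, 'a::comm_ring_1) mfps)"
proof (induction P)
  case (Suc P)
  have "order_ge (1 + P) ((vq 0 * vq (Suc (P mod m))) * (level_monomial m P :: (indet, 'a) mfps))"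
    by (intro order_ge_mult order_ge_mult_right order_ge_X Suc)
  then show ?case
    by (simp add: level_monomial_def mult_ac)
qed simp

lemma order_ge_qmon: "j \<ge> 1 \<Longrightarrow> order_ge 1 (qmon j)"
  using order_ge_mono[OF order_ge_level_monomial[of j j], of 1] by (simp add: level_monomial_eq_qmon)

text \<open>
  The weight contributed by a level of size \<open>k\<close> when \<open>P\<close> parts have size at least \<open>k\<close> and \<open>b\<close> says
  whether \<open>k\<close> over-lined occurs. The \<open>m\<close>-th plain weight is 1, as the statement has no \<open>c\<^sub>m\<close>.
\<close>

definition level_weight ::
  "(nat \<Rightarrow> (indet, 'a::comm_ring_1) mfps) \<Rightarrow> (nat \<Rightarrow> (indet, 'a) mfps) \<Rightarrow> nat \<Rightarrow> nat \<Rightarrow> bool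
     \<Rightarrow> (indet, 'a) mfps" where
  "level_weight u v m P b = level_monomial m P *
     (if b then v (if m dvd P then m else P mod m) else if m dvd P then 1 else u (P mod m))"

text \<open>Arbitrary series \<open>u\<close> and \<open>v\<close> replace the indeterminates
  \<open>c\<close>, so that they can later be set to 0.\<close>

definition overpart_weight ::
  "(nat \<Rightarrow> (indet, 'a::comm_ring_1) mfps) \<Rightarrow> (nat \<Rightarrow> (indet, 'a) mfps) \<Rightarrow> nat \<Rightarrow> (nat \<Rightarrow> part)
     \<Rightarrow> (indet, 'a) mfps" where
  "overpart_weight u v m l = (\<Prod>j=1..<m. u j ^ nat (rho m j l) * v j ^ rho_bar m j l)
     * v m ^ rho_bar m m l * vq 0 ^ weight l * (\<Prod>i=1..m. vq i ^ class_sum m i l)"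

lemma overpart_weight_Plain_0: "overpart_weight u v m (\<lambda>_. Plain 0) = 1"
  by (simp add: overpart_weight_def rho_def rho_bar_def weight_def class_sum_def sz_def ov_def part_at_def)

lemma order_ge_overpart_weight: "order_ge (weight l) (overpart_weight u v m l)"
  unfolding overpart_weight_def
  by (intro order_ge_mult_right order_ge_mult_left order_ge_power order_ge_X)

lemma order_ge_level_weight: "order_ge P (level_weight u v m P b)"
  unfolding level_weight_def by (intro order_ge_mult_right order_ge_level_monomial)

lemma level_weight_0: "level_weight u v m 0 False = 1"
  by (simp add: level_weight_def level_monomial_def)

lemma level_weight_add_mult: "level_weight u v m (P + k * m) b = qmon m ^ k * level_weight u v m P b"
  by (simp add: level_weight_def level_monomial_add_mult level_monomial_eq_qmon mult_ac)

section \<open>Change of the statistics under a new lowest level\<close>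

context
  fixes l :: "nat \<Rightarrow> part" and m :: nat
  assumes l: "overpartition l" and m: "m \<ge> 1"
begin

lemma finite_sz_progression: "finite {i. sz l (j + i * m) \<noteq> 0}"
proof -
  have "j + i * m \<le> nparts l" if "sz l (j + i * m) \<noteq> 0" for i
    using psize_pos_iff[OF l, of "j + i * m - 1"] that by (auto simp: sz_def part_at_def)
  then have "{i. sz l (j + i * m) \<noteq> 0} \<subseteq> {i. j + i * m \<le> nparts l}"
    by blast
  then show ?thesis
    by (rule finite_subset) (rule finite_progression(1)[OF m])
qed

lemma ov_imp_sz: "i \<ge> 1 \<Longrightarrow> ov l i \<Longrightarrow> sz l i \<noteq> 0"
  using psize_pos_iff[OF l, of "i - 1"] overpartition_over_pos[OF l, of "i - 1"]
  by (simp add: sz_def ov_def part_at_def)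

lemma finite_ov_progression: "1 \<le> j \<Longrightarrow> finite {i. ov l (j + i * m)}"
  by (rule finite_subset[OF _ finite_sz_progression[of j]]) (auto dest: ov_imp_sz[rotated])

context
  fixes n :: nat and b :: bool and l' :: "nat \<Rightarrow> part" and P :: nat
  assumes l': "l' = add_level l n b" and P: "P = nparts l + n + of_bool b"
begin

lemma sz_add_level: "i \<ge> 1 \<Longrightarrow> sz l' i = sz l i + of_bool (i \<le> P)"
  by (auto simp: sz_def part_at_def l' P psize_add_level[OF l])

lemma ov_add_level: "i \<ge> 1 \<Longrightarrow> ov l' i \<longleftrightarrow> ov l i \<or> b \<and> i = P"
  by (auto simp: ov_def part_at_def l' P is_over_add_level[OF l])

lemma not_ov_top: "b \<Longrightarrow> \<not> ov l P"
  using overpartition_over_pos[OF l, of "P - 1"] by (auto simp: ov_def part_at_def P)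

lemma class_sum_add_level: "i \<ge> 1 \<Longrightarrow> class_sum m i l' = class_sum m i l + card {j. i + j * m \<le> P}"
  using Sum_any_add_of_bool[OF finite_sz_progression[of i] finite_progression(1)[OF m, of i P]]
  by (simp add: class_sum_def sz_add_level)

lemma weight_add_level: "weight l' = weight l + P"
proof -
  have "finite {i. sz l (i + 1) \<noteq> 0}"
    using psize_pos_iff[OF l] by (simp add: sz_def part_at_def)
  moreover have "{i. i + 1 \<le> P} = {..<P}"
    by auto
  ultimately show ?thesis
    using Sum_any_add_of_bool[of "\<lambda>i. sz l (i + 1)" "\<lambda>i. i + 1 \<le> P"]
    by (simp add: weight_def sz_add_level)
qed

lemma rho_bar_add_level:
  assumes j: "j \<ge> 1"
  shows "rho_bar m j l' = rho_bar m j l + of_bool ((\<exists>i. j + i * m = P) \<and> b)"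
proof -
  have "{i. ov l' (j + i * m)} = {i. ov l (j + i * m)} \<union> {i. j + i * m = P \<and> b}"
    using j by (auto simp: ov_add_level)
  moreover have "card ({i. ov l (j + i * m)} \<union> {i. j + i * m = P \<and> b})
      = card {i. ov l (j + i * m)} + card {i. j + i * m = P \<and> b}"
    by (rule card_Un_disjoint)
      (use finite_ov_progression[OF j] finite_progression[OF m] not_ov_top in auto)
  ultimately show ?thesis
    unfolding rho_bar_def by (simp add: card_progression_eq[OF m])
qed

text \<open>Raising the first \<open>P\<close> sizes by 1 changes consecutive differences only at
  position \<open>P\<close>, where the gain is absorbed exactly if that position becomes
  over-lined.\<close>

lemma rho_add_level:
  assumes j: "j \<ge> 1"
  shows "rho m j l' = rho m j l + of_bool ((\<exists>i. j + i * m = P) \<and> \<not> b)"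
proof -
  have summand: "int (sz l' (j + i * m)) - int (sz l' (j + 1 + i * m)) - of_bool (ov l' (j + i * m))
      = (int (sz l (j + i * m)) - int (sz l (j + 1 + i * m)) - of_bool (ov l (j + i * m)))
        + of_bool (j + i * m = P \<and> \<not> b)" for i
    using j not_ov_top by (auto simp: sz_add_level ov_add_level)
  have "finite {i. int (sz l (j + i * m)) - int (sz l (j + 1 + i * m)) - of_bool (ov l (j + i * m)) \<noteq> 0}"
    by (rule finite_subset[OF _ finite_UnI[OF finite_UnI[OF finite_sz_progression[of j]
          finite_sz_progression[of "j + 1"]] finite_ov_progression[OF j]]]) auto
  then show ?thesis
    unfolding rho_def summand
    by (subst Sum_any_add_of_bool) (simp_all add: finite_progression[OF m] card_progression_eq[OF m])
qed

text \<open>Each statistic is additive over levels, which yields the multiplicativity required by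
  \<open>sum_Pbar_upto\<close>.\<close>

lemma overpart_weight_add_level:
  fixes u v :: "nat \<Rightarrow> (indet, 'a::comm_ring_1) mfps"
  shows "overpart_weight u v m l' = overpart_weight u v m l * level_weight u v m P b"
proof -
  let ?B = "v (if m dvd P then m else P mod m)"
  let ?U = "if m dvd P then 1 else u (P mod m)"
  have P0: "b \<Longrightarrow> P \<ge> 1"
    by (simp add: P)
  \<comment> \<open>Position \<open>P\<close> lies in one residue class only, so at most one factor
    survives, and none if \<open>m\<close> divides \<open>P\<close>.\<close>
  have delta: "(\<Prod>j=1..<m. f j ^ of_bool ((\<exists>i. j + i * m = P) \<and> c))
      = (if c \<and> \<not> m dvd P then f (P mod m) else 1)" for f :: "nat \<Rightarrow> (indet, 'a) mfps" and c
  proof -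
    have "(\<Prod>j=1..<m. f j ^ of_bool ((\<exists>i. j + i * m = P) \<and> c))
        = (\<Prod>j=1..<m. if P mod m = j then (if c then f j else 1) else 1)"
      by (rule prod.cong) (auto simp: residue_progression_iff)
    also have "\<dots> = (if c \<and> \<not> m dvd P then f (P mod m) else 1)"
      using m by (auto simp: prod.delta' dvd_eq_mod_eq_0)
    finally show ?thesis .
  qed
  have U: "(\<Prod>j=1..<m. u j ^ nat (rho m j l')) = (\<Prod>j=1..<m. u j ^ nat (rho m j l)) * (if b then 1 else ?U)"
  proof -
    have "(\<Prod>j=1..<m. u j ^ nat (rho m j l'))
       = (\<Prod>j=1..<m. u j ^ nat (rho m j l) * u j ^ of_bool ((\<exists>i. j + i * m = P) \<and> \<not> b))"
      using rho_nonneg[OF l] by (intro prod.cong) (auto simp: rho_add_level nat_add_distrib power_add)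
    then show ?thesis
      unfolding prod.distrib delta by auto
  qed
  have V: "(\<Prod>j=1..<m. v j ^ rho_bar m j l') * v m ^ rho_bar m m l'
     = (\<Prod>j=1..<m. v j ^ rho_bar m j l) * v m ^ rho_bar m m l * (if b then ?B else 1)"
  proof -
    have "(\<Prod>j=1..<m. v j ^ rho_bar m j l')
       = (\<Prod>j=1..<m. v j ^ rho_bar m j l * v j ^ of_bool ((\<exists>i. j + i * m = P) \<and> b))"
      by (intro prod.cong) (auto simp: rho_bar_add_level power_add)
    then show ?thesis
      unfolding prod.distrib delta
      using P0 m by (auto simp: rho_bar_add_level multiple_progression_iff power_add mult_ac)
  qed
  have Q: "(vq 0 ^ weight l' * (\<Prod>i=1..m. vq i ^ class_sum m i l') :: (indet, 'a) mfps)
     = vq 0 ^ weight l * (\<Prod>i=1..m. vq i ^ class_sum m i l) * level_monomial m P"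
  proof -
    have "((\<Prod>i=1..m. vq i ^ class_sum m i l') :: (indet, 'a) mfps)
      = (\<Prod>i=1..m. vq i ^ class_sum m i l * vq i ^ card {j. i + j * m \<le> P})"
      by (rule prod.cong) (auto simp: class_sum_add_level power_add)
    then show ?thesis
      unfolding prod.distrib level_monomial_eq_prod[OF m]
      by (simp add: weight_add_level power_add mult_ac)
  qed
  have split: "overpart_weight u v m l = (\<Prod>j=1..<m. u j ^ nat (rho m j l))
     * ((\<Prod>j=1..<m. v j ^ rho_bar m j l) * v m ^ rho_bar m m l)
     * (vq 0 ^ weight l * (\<Prod>i=1..m. vq i ^ class_sum m i l))" for l
    by (simp add: overpart_weight_def prod.distrib mult_ac)
  show ?thesis
    unfolding split U V Q level_weight_def by (simp add: mult_ac)
qed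

end

lemma psize_le_weight: "psize (l i) \<le> weight l"
proof (cases "i < nparts l")
  case True
  have "weight l = (\<Sum>i<nparts l. psize (l i))"
    unfolding weight_def
    by (subst Sum_any.expand_superset[of "{..<nparts l}"])
      (use psize_pos_iff[OF l] in \<open>auto simp: sz_def part_at_def\<close>)
  then show ?thesis
    using True member_le_sum[of i "{..<nparts l}" "\<lambda>i. psize (l i)"] by simp
next
  case False
  then show ?thesis
    using psize_pos_iff[OF l, of i] by simp
qed

end

section \<open>The general identity and its specialisations\<close>

text \<open>Terms outside \<open>E K\<close> are invisible below degree \<open>K\<close>, so every
  finite set containing \<open>E (Suc (mdegree \<mu>))\<close> already gives the coefficient of
  \<open>S\<close> at \<mu>.\<close>

lemma has_sum_mfps_exhaustion:
  fixes f :: "'b \<Rightarrow> ('v, 'a::comm_ring_1) mfps"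
  assumes fin: "\<And>K. finite (E K)" and sub: "\<And>K. E K \<subseteq> A"
    and tail: "\<And>K x. x \<in> A \<Longrightarrow> x \<notin> E K \<Longrightarrow> order_ge K (f x)"
    and sum: "\<And>K. mcong K (\<Sum>x\<in>E K. f x) S"
  shows "(f has_sum S) A"
  unfolding has_sum_def tendsto_mfps_iff eventually_finite_subsets_at_top
proof
  fix \<mu> :: "'v \<Rightarrow>\<^sub>0 nat"
  let ?K = "Suc (mdegree \<mu>)"
  have "mcoeff (sum f Y) \<mu> = mcoeff S \<mu>" if Y: "finite Y" "E ?K \<subseteq> Y" "Y \<subseteq> A" for Y
  proof -
    have "sum f Y - sum f (E ?K) = sum f (Y - E ?K)"
      using Y by (simp add: sum_diff)
    moreover have "order_ge ?K (sum f (Y - E ?K))"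
      using Y tail by (intro order_ge_sum) auto
    ultimately have "mcong ?K (sum f Y) (sum f (E ?K))"
      by (simp add: mcong_def)
    then have "mcong ?K (sum f Y) S"
      using sum mcong_trans by blast
    then show ?thesis
      by (simp add: mcong_iff)
  qed
  then show "\<exists>X. finite X \<and> X \<subseteq> A \<and>
      (\<forall>Y. finite Y \<and> X \<subseteq> Y \<and> Y \<subseteq> A \<longrightarrow> mcoeff (sum f Y) \<mu> = mcoeff S \<mu>)"
    by (intro exI[of _ "E ?K"] conjI fin sub) simp
qed

text \<open>Each residue class of indices will become one truncated
  \<open>qpoch_inf\<close>.\<close>

lemma prod_residue_classes:
  fixes f :: "nat \<Rightarrow> 'b::comm_monoid_mult"
  shows "(\<Prod>i=1..K*m. f i) = (\<Prod>j=1..m. \<Prod>k<K. f (j + k * m))"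
proof (induction K)
  case (Suc K)
  have "(\<Prod>i=1..Suc K*m. f i) = (\<Prod>i=1..K*m+m. f i)"
    by (simp add: add.commute)
  also have "\<dots> = (\<Prod>i=1..K*m. f i) * (\<Prod>i=K*m+1..K*m+m. f i)"
    by (rule prod.ub_add_nat) simp
  also have "(\<Prod>i=K*m+1..K*m+m. f i) = (\<Prod>j=1..m. f (j + K * m))"
    using prod.shift_bounds_cl_nat_ivl[of f 1 "K * m" m] by (simp add: add.commute)
  finally show ?case
    using Suc by (simp add: prod.distrib)
qed simp

lemma prod_atLeastAtMost_last:
  fixes f :: "nat \<Rightarrow> 'b::comm_monoid_mult"
  assumes "m \<ge> 1"
  shows "(\<Prod>j=1..m. f j) = (\<Prod>j=1..<m. f j) * f m"
proof -
  have "{1..m} = insert m {1..<m}"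
    using assms by auto
  then show ?thesis
    by (simp add: mult.commute)
qed

theorem has_sum_overpart_weight:
  fixes u v :: "nat \<Rightarrow> (indet, 'a::comm_ring_1) mfps"
  assumes m: "m \<ge> 1"
  shows "(overpart_weight u v m has_sum
      (qpoch_inf (- (v m * qmon m)) (qmon m)
        * (\<Prod>i=1..<m. qpoch_inf (- (v i * qmon i)) (qmon m) / qpoch_inf (u i * qmon i) (qmon m))))
      (Pbar m)" (is "(_ has_sum ?R) _")
proof (rule has_sum_mfps_exhaustion)
  let ?x = "qmon m :: (indet, 'a) mfps"
  let ?z = "level_weight u v m"
  \<comment> \<open>This factor enforces the multiplicity bound and also comes from the plain
    factors whose index is divisible by \<open>m\<close>; it cancels at the end.\<close>
  let ?qx = "qpoch_inf ?x ?x"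
  let ?U = "\<Prod>i=1..<m. qpoch_inf (u i * qmon i) ?x"
  let ?V = "\<Prod>i=1..m. qpoch_inf (- (v i * qmon i)) ?x"
  have ox: "order_ge 1 ?x"
    using m by (rule order_ge_qmon)
  have oq: "order_ge 1 (f * qmon i)" "order_ge 1 (- (f * qmon i))" if "i \<ge> 1" for f :: "(indet, 'a) mfps" and i
    using order_ge_mult_left[OF order_ge_qmon[OF that], of f]
      order_ge_mult_left[OF order_ge_qmon[OF that], of "- f"] by simp_all
  \<comment> \<open>Clearing the denominators keeps the congruences free of division.\<close>
  have RU: "?R * ?U = ?V"
  proof -
    have "(\<Prod>i=1..<m. qpoch_inf (- (v i * qmon i)) ?x / qpoch_inf (u i * qmon i) ?x) * ?U
        = (\<Prod>i=1..<m. qpoch_inf (- (v i * qmon i)) ?x)"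
      unfolding prod.distrib[symmetric]
      by (intro prod.cong refl mfps_divide_mult_cancel mcoeff_qpoch_inf_0 oq ox) auto
    then show ?thesis
      unfolding prod_atLeastAtMost_last[OF m] by (simp add: mult_ac)
  qed
  have z_plain: "?z (j + k * m) False = (u j * qmon j) * ?x ^ k" if "1 \<le> j" "j < m" for j k
  proof -
    have "\<not> m dvd j"
      using that by (auto dest: dvd_imp_le)
    then show ?thesis
      unfolding level_weight_add_mult using that
      by (simp add: level_weight_def level_monomial_eq_qmon mult_ac)
  qed
  have z_plain_m: "?z (m + k * m) False = ?x * ?x ^ k" for k
    unfolding level_weight_add_mult
    by (simp add: level_weight_def level_monomial_eq_qmon mult_ac)
  have z_over: "?z (j + k * m) True = (v j * qmon j) * ?x ^ k" if "1 \<le> j" "j \<le> m" for j k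
  proof -
    have "(if m dvd j then m else j mod m) = j"
      using that by (cases "j = m") (auto simp: le_less dest: dvd_imp_le)
    then show ?thesis
      unfolding level_weight_add_mult using that
      by (simp add: level_weight_def level_monomial_eq_qmon mult_ac)
  qed
  fix K
  \<comment> \<open>Sizes up to \<open>K\<close> give \<open>K\<close> levels that add at most
    \<open>m\<close> parts each, so \<open>K * m\<close> bounds the counts; the range
    \<open>1..K*m\<close> also splits into \<open>m\<close> residue classes of \<open>K\<close>
    terms.\<close>
  let ?B = "bounded_path_sum ?z m K 0" and ?A = "path_sum ?z (K * m) K 0"
  let ?D = "\<Prod>i=1..K. 1 - ?x ^ i"
  let ?Z0 = "\<Prod>i=1..K*m. 1 - ?z i False" and ?Z1 = "\<Prod>i=1..K*m. 1 + ?z i True"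
  have shift: "?z (P + m) b = ?x * ?z P b" for P b
    using level_weight_add_mult[of u v m P 1 b] by simp
  have Km: "K \<le> K * m"
    using m by simp
  have D: "mcong K ?D ?qx"
  proof -
    have "?D = (\<Prod>k<K. 1 - ?x * ?x ^ k)"
      by (simp add: prod.atLeast1_atMost_eq)
    then show ?thesis
      using mcong_sym[OF mcong_qpoch_inf[OF ox ox]] by simp
  qed
  have Z0: "mcong K ?Z0 (?U * ?qx)"
  proof -
    have "?Z0 = (\<Prod>j=1..<m. \<Prod>k<K. 1 - (u j * qmon j) * ?x ^ k) * (\<Prod>k<K. 1 - ?x * ?x ^ k)"
      unfolding prod_residue_classes prod_atLeastAtMost_last[OF m] z_plain_m
      by (intro arg_cong2[where f = "(*)"] prod.cong refl) (simp add: z_plain)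
    also have "mcong K \<dots> (?U * ?qx)"
      by (intro mcong_mult mcong_prod mcong_sym[OF mcong_qpoch_inf] oq ox) auto
    finally show ?thesis .
  qed
  have Z1: "mcong K ?Z1 ?V"
  proof -
    have "?Z1 = (\<Prod>j=1..m. \<Prod>k<K. 1 - (- (v j * qmon j)) * ?x ^ k)"
      unfolding prod_residue_classes
      by (intro prod.cong refl) (simp add: z_over)
    also have "mcong K \<dots> ?V"
      by (intro mcong_prod mcong_sym[OF mcong_qpoch_inf] oq ox) auto
    finally show ?thesis .
  qed
  \<comment> \<open>\<open>?B\<close> and \<open>?R\<close> are compared after multiplication by the
    unit \<open>?U * ?qx\<close>: \<open>?B\<close> becomes the free sum \<open>?A\<close> times
    \<open>?D\<close>, and \<open>?A * ?Z0\<close> becomes \<open>?Z1\<close>.\<close>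
  have "mcong K (?B * (?U * ?qx)) (?B * ?Z0)"
    by (intro mcong_mult mcong_refl mcong_sym[OF Z0])
  also have "mcong K \<dots> (?A * ?D * ?Z0)"
    by (intro mcong_mult mcong_refl mcong_mono[OF mcong_sym[OF mcong_path_sum_bounded] Km]
        order_ge_level_weight level_weight_0 shift) simp
  also have "?A * ?D * ?Z0 = ?A * ?Z0 * ?D"
    by (simp only: mult_ac)
  also have "mcong K \<dots> (?Z1 * ?D)"
    by (intro mcong_mult mcong_refl mcong_path_sum_prod order_ge_level_weight level_weight_0)
  also have "mcong K \<dots> (?V * ?qx)"
    by (intro mcong_mult Z1 D)
  also have "?V * ?qx = ?R * (?U * ?qx)"
    unfolding RU[symmetric] by (simp only: mult.assoc)
  finally have "mcong K ?B ?R"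
  proof (rule mcong_mult_cancel)
    have "mcong 1 (?U * ?qx) ((\<Prod>i=1..<m. 1) * 1)"
      using mcoeff_qpoch_inf_0[OF oq(1) ox] mcoeff_qpoch_inf_0[OF ox ox]
      by (intro mcong_mult mcong_prod) (auto simp: mcong_iff mdegree_eq_0_iff)
    from mcoeff_zero_eqI[OF this] show "mcoeff (?U * ?qx) 0 = 1"
      by simp
  qed
  moreover have "(\<Sum>l\<in>Pbar_upto m K. overpart_weight u v m l) = ?B"
    by (intro sum_Pbar_upto m overpart_weight_Plain_0 overpart_weight_add_level) auto
  ultimately show "mcong K (\<Sum>l\<in>Pbar_upto m K. overpart_weight u v m l) ?R"
    by simp
next
  fix K l
  assume l: "l \<in> Pbar m" "l \<notin> Pbar_upto m K"
  \<comment> \<open>A part exceeding \<open>K\<close> makes the total size exceed \<open>K\<close>,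
    and the power of \<open>vq 0\<close> alone then gives the required order.\<close>
  then obtain i where "psize (l i) > K"
    by (auto simp: Pbar_upto_def not_le)
  moreover have "psize (l i) \<le> weight l"
    using l m by (intro psize_le_weight) (auto simp: Pbar_iff)
  ultimately show "order_ge K (overpart_weight u v m l)"
    by (intro order_ge_mono[OF order_ge_overpart_weight]) simp
next
  show "finite (Pbar_upto m K)" for K
    using m by (rule finite_Pbar_upto)
qed (auto simp: Pbar_upto_def)

text \<open>The residue classes of \<open>1..m\<close> cover all positions. In this form, membership
  is detected by the exponents of the over-lined weights.\<close>

lemma Pset_iff:
  assumes m: "m \<ge> 1"
  shows "l \<in> Pset m \<longleftrightarrow> l \<in> Pbar m \<and> (\<forall>j\<in>{1..m}. rho_bar m j l = 0)"
proof (cases "l \<in> Pbar m")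
  case True
  then have l: "overpartition l"
    by (simp add: Pbar_iff)
  have "(\<forall>i\<ge>1. \<not> ov l i) \<longleftrightarrow> (\<forall>j\<in>{1..m}. \<forall>i. \<not> ov l (j + i * m))"
  proof
    assume R: "\<forall>j\<in>{1..m}. \<forall>i. \<not> ov l (j + i * m)"
    show "\<forall>i\<ge>1. \<not> ov l i"
    proof (intro allI impI)
      fix i :: nat assume i: "i \<ge> 1"
      have "Suc ((i - 1) mod m) + (i - 1) div m * m = i"
        using i by (metis Suc_diff_1 add_Suc less_eq_Suc_le mod_div_mult_eq One_nat_def)
      moreover have "Suc ((i - 1) mod m) \<in> {1..m}"
        using m by (simp add: Suc_leI)
      ultimately show "\<not> ov l i"
        using R by metis
    qed
  qed auto
  also have "\<dots> \<longleftrightarrow> (\<forall>j\<in>{1..m}. rho_bar m j l = 0)"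
    using finite_ov_progression[OF l m] by (simp add: rho_bar_def)
  finally show ?thesis
    using True by (simp add: Pset_def)
qed (simp add: Pset_def)

text \<open>All summands of \<open>rho\<close> are nonnegative, so its vanishing forces each of them
  to vanish; the classes in \<open>1..<m\<close> are exactly the positions not divisible by
  \<open>m\<close>.\<close>

lemma Fbar_iff:
  assumes m: "m \<ge> 1"
  shows "l \<in> Fbar m \<longleftrightarrow> l \<in> Pbar m \<and> (\<forall>j\<in>{1..<m}. rho m j l = 0)"
proof (cases "l \<in> Pbar m")
  case True
  then have l: "overpartition l"
    by (simp add: Pbar_iff)
  define d where "d i = int (sz l i) - int (sz l (i + 1)) - of_bool (ov l i)" for i
  have d_nonneg: "d i \<ge> 0" if "i \<ge> 1" for i
    using overpartition_step[OF l, of "i - 1"] that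
    by (auto simp: d_def sz_def ov_def part_at_def)
  have rho: "rho m j l = 0 \<longleftrightarrow> (\<forall>i. d (j + i * m) = 0)" if j: "j \<ge> 1" for j
  proof -
    have eq: "rho m j l = Sum_any (\<lambda>i. d (j + i * m))"
      by (simp add: rho_def d_def add_ac)
    have fin: "finite {i. d (j + i * m) \<noteq> 0}"
      unfolding d_def
      by (rule finite_subset[OF _ finite_UnI[OF finite_UnI[OF finite_sz_progression[OF l m, of j]
          finite_sz_progression[OF l m, of "j + 1"]] finite_ov_progression[OF l m j]]])
        (auto simp: add_ac)
    show ?thesis
      unfolding eq Sum_any.expand_set using fin d_nonneg j
      by (subst sum_nonneg_eq_0_iff) auto
  qed
  have "(\<forall>i\<ge>1. \<not> m dvd i \<longrightarrow> int (sz l i) - int (sz l (i + 1)) = of_bool (ov l i))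
      \<longleftrightarrow> (\<forall>i\<ge>1. \<not> m dvd i \<longrightarrow> d i = 0)"
    by (simp add: d_def)
  also have "\<dots> \<longleftrightarrow> (\<forall>j\<in>{1..<m}. \<forall>i. d (j + i * m) = 0)"
  proof
    assume L: "\<forall>i\<ge>1. \<not> m dvd i \<longrightarrow> d i = 0"
    show "\<forall>j\<in>{1..<m}. \<forall>i. d (j + i * m) = 0"
    proof (intro ballI allI)
      fix j i assume "j \<in> {1..<m}"
      then have "\<not> m dvd j + i * m" "j + i * m \<ge> 1"
        by (auto dest: dvd_imp_le)
      with L show "d (j + i * m) = 0" by blast
    qed
  next
    assume R: "\<forall>j\<in>{1..<m}. \<forall>i. d (j + i * m) = 0"
    show "\<forall>i\<ge>1. \<not> m dvd i \<longrightarrow> d i = 0"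
    proof (intro allI impI)
      fix i assume "\<not> m dvd i"
      then have "i mod m \<in> {1..<m}"
        using m by (auto simp: dvd_eq_mod_eq_0 Suc_le_eq)
      then have "d (i mod m + i div m * m) = 0"
        using R by blast
      then show "d i = 0"
        by simp
    qed
  qed
  also have "\<dots> \<longleftrightarrow> (\<forall>j\<in>{1..<m}. rho m j l = 0)"
    using rho by auto
  finally show ?thesis
    using True by (simp add: Fbar_def)
qed (simp add: Fbar_def)

theorem corollary1p18:
  fixes m :: nat
  assumes "m \<ge> 1"
  shows
    "((\<lambda>l. (\<Prod>j=1..<m. vc j ^ nat (rho m j l) * vcbar j ^ rho_bar m j l)
              * vcbar m ^ rho_bar m m l
              * vq 0 ^ weight l * (\<Prod>i=1..m. vq i ^ class_sum m i l)
          :: (indet, 'a::comm_ring_1) mfps)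
        has_sum
        (qpoch_inf (- (vcbar m * qmon m)) (qmon m)
         * (\<Prod>i=1..<m. qpoch_inf (- (vcbar i * qmon i)) (qmon m)
                       / qpoch_inf (vc i * qmon i) (qmon m)))) (Pbar m)
     \<and>
     ((\<lambda>l. (\<Prod>j=1..<m. vc j ^ nat (rho m j l))
              * vq 0 ^ weight l * (\<Prod>i=1..m. vq i ^ class_sum m i l)
          :: (indet, 'a) mfps)
        has_sum
        (\<Prod>i=1..<m. 1 / qpoch_inf (vc i * qmon i) (qmon m))) (Pset m)
     \<and>
     ((\<lambda>l. (\<Prod>j=1..m. vcbar j ^ rho_bar m j l)
              * vq 0 ^ weight l * (\<Prod>i=1..m. vq i ^ class_sum m i l)
          :: (indet, 'a) mfps)
        has_sum
        (\<Prod>i=1..m. qpoch_inf (- (vcbar i * qmon i)) (qmon m))) (Fbar m)"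
proof (intro conjI)
  show "((\<lambda>l. (\<Prod>j=1..<m. vc j ^ nat (rho m j l) * vcbar j ^ rho_bar m j l)
        * vcbar m ^ rho_bar m m l * vq 0 ^ weight l * (\<Prod>i=1..m. vq i ^ class_sum m i l)
        :: (indet, 'a) mfps) has_sum
      (qpoch_inf (- (vcbar m * qmon m)) (qmon m)
        * (\<Prod>i=1..<m. qpoch_inf (- (vcbar i * qmon i)) (qmon m) / qpoch_inf (vc i * qmon i) (qmon m))))
      (Pbar m)"
    using has_sum_overpart_weight[OF assms, of vc vcbar] unfolding overpart_weight_def .
next
  let ?f = "\<lambda>l. (\<Prod>j=1..<m. vc j ^ nat (rho m j l)) * vq 0 ^ weight l
      * (\<Prod>i=1..m. vq i ^ class_sum m i l) :: (indet, 'a) mfps"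
  \<comment> \<open>Setting the over-lined weights to 0 selects \<open>Pset m\<close>, as
    \<open>0 ^ 0 = 1\<close> and positive powers of 0 vanish; the numerators become 1 by
    \<open>qpoch_inf_0\<close>.\<close>
  let ?w = "overpart_weight vc (\<lambda>_. 0 :: (indet, 'a) mfps) m"
  have "?w l = (if l \<in> Pset m then ?f l else 0)" if "l \<in> Pbar m" for l
  proof (cases "l \<in> Pset m")
    case True
    then show ?thesis
      using assms by (simp add: Pset_iff[OF assms] overpart_weight_def)
  next
    case False
    from False that obtain j where "j \<in> {1..m}" "rho_bar m j l \<noteq> 0"
      by (auto simp: Pset_iff[OF assms])
    then have "(\<Prod>j=1..m. (0 :: (indet, 'a) mfps) ^ rho_bar m j l) = 0"
      by (intro prod_zero bexI[of _ j]) (auto simp: zero_power)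
    then show ?thesis
      using False unfolding prod_atLeastAtMost_last[OF assms]
      by (simp add: overpart_weight_def prod.distrib mult.assoc)
  qed
  then have "(?w has_sum S) (Pbar m) \<longleftrightarrow> (?f has_sum S) (Pset m)" for S
    by (intro has_sum_cong_neutral) (auto simp: Pset_def)
  then show "(?f has_sum (\<Prod>i=1..<m. 1 / qpoch_inf (vc i * qmon i) (qmon m))) (Pset m)"
    using has_sum_overpart_weight[OF assms, of vc "\<lambda>_. 0 :: (indet, 'a) mfps"] by simp
next
  let ?f = "\<lambda>l. (\<Prod>j=1..m. vcbar j ^ rho_bar m j l) * vq 0 ^ weight l
      * (\<Prod>i=1..m. vq i ^ class_sum m i l) :: (indet, 'a) mfps"
  \<comment> \<open>Setting the plain weights to 0 instead selects \<open>Fbar m\<close> and turns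
    the denominators into 1.\<close>
  let ?w = "overpart_weight (\<lambda>_. 0 :: (indet, 'a) mfps) vcbar m"
  have "?w l = (if l \<in> Fbar m then ?f l else 0)" if "l \<in> Pbar m" for l
  proof (cases "l \<in> Fbar m")
    case True
    then show ?thesis
      unfolding Fbar_iff[OF assms] overpart_weight_def prod_atLeastAtMost_last[OF assms]
      by simp
  next
    case False
    have "overpartition l"
      using that by (simp add: Pbar_iff)
    with False that obtain j where "j \<in> {1..<m}" "nat (rho m j l) \<noteq> 0"
      using rho_nonneg[of l _ m] by (auto simp: Fbar_iff[OF assms]) (metis antisym)
    then have "(\<Prod>j=1..<m. (0 :: (indet, 'a) mfps) ^ nat (rho m j l)) = 0"
      by (intro prod_zero bexI[of _ j]) (auto simp: zero_power)
    then show ?thesis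
      using False by (simp add: overpart_weight_def prod.distrib)
  qed
  then have "(?w has_sum S) (Pbar m) \<longleftrightarrow> (?f has_sum S) (Fbar m)" for S
    by (intro has_sum_cong_neutral) (auto simp: Fbar_def)
  then show "(?f has_sum (\<Prod>i=1..m. qpoch_inf (- (vcbar i * qmon i)) (qmon m))) (Fbar m)"
    using has_sum_overpart_weight[OF assms, of "\<lambda>_. 0 :: (indet, 'a) mfps" vcbar]
    unfolding prod_atLeastAtMost_last[OF assms] by (simp add: mfps_divide_1 mult.commute)
qed

end
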